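(* Let $\mathcal{G}_1$ and $\mathcal{G}_2$ be two simple DAGs on the same finite vertex set $V$. Then $\mathcal{M}_{\mathcal{G}_1}=\mathcal{M}_{\mathcal{G}_2}$ if and only if there exists a (finite, possibly empty) sequence of super-covered edge flips that transforms $\mathcal{G}_1$ into $\mathcal{G}_2$. Moreover, if $\mathcal{M}_{\mathcal{G}_1}=\mathcal{M}_{\mathcal{G}_2}$ and $\delta=|E(\mathcal{G}_1)\setminus E(\mathcal{G}_2)|$, then there is a sequence of $\delta$ super-covered edge flips that transforms $\mathcal{G}_1$ into $\mathcal{G}_2$.
   Context: All graphs are finite directed graphs $\mathcal{G}=(V,E)$, $E=E(\mathcal{G})$, without multiple edges, whose edge set $E\subseteq V\times V$ contains every self-loop $i\to i$. A graph is simple if for all distinct $i,j$ it contains at most one of $i\to j$, $j\to i$. Self-loops are ignored for acyclicity and for parents, children and neighbors: $\mathrm{pa}(i)=\{j\ne i: j\to i\in E\}$, $\mathrm{ch}(i)=\{j\neq i: i\to j\in E\}$, $\mathrm{ne}(i)=\mathrm{pa}(i)\cup\mathrm{ch}(i)$. A DAG is a graph with no directed cycle of length greater than one. $\mathbb{R}^E$ is the set of real $V\times V$ matrices $M$ with $m_{ji}=0$ whenever $i\to j\notin E$; a matrix is stable if all its eigenvalues have strictly negative real part; $\mathrm{PD}_V$ is the set of real symmetric positive definite $V\times V$ matrices. The graphical continuous Lyapunov model of $\mathcal{G}$ is $\mathcal{M}_{\mathcal{G}}=\{\Sigma\in\mathrm{PD}_V : M\Sigma+\Sigma M^T+2I=0\text{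 for some stable }M\in\mathbb{R}^E\}$. A trek between $i$ and $j$ is a sequence of edges $i=i_l\leftarrow i_{l-1}\leftarrow\cdots\leftarrow i_0=j_0\to j_1\to\cdots\to j_r=j$ with $l,r\ge 0$. The marginal independence $k\perp\!\!\!\perp\{i,j\}$ is equivalent to there being no trek between $k$ and $i$ and no trek between $k$ and $j$ in $\mathcal{G}$. A non-loop edge $i\to j$ of a simple DAG is super-covered if: (1) $\mathrm{ch}(i)=\mathrm{ch}(j)\cup\{j\}$ and $\mathrm{pa}(i)\cup\{i\}=\mathrm{pa}(j)$; (2) for each $k\in\mathrm{pa}(j)$ and $l\in\mathrm{ch}(i)$, $k\to l\in E$; (3) for all $k\in V\setminus\{i,j\}$, either $k\in\mathrm{ne}(i)\cap\mathrm{ne}(j)$ or $k\perp\!\!\!\perp\{i,j\}$. A super-covered edge flip replaces an edge $i\to j$ that is super-covered in the current graph by $j\to i$. *)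

theory Defs
  imports "HOL-Analysis.Analysis"
begin

text \<open>
  The vertex set of a graph is the finite type \<open>'v\<close>, and a graph is given by its edge set \<open>E\<close>,
  with \<open>(i, j) \<in> E\<close> for \<open>i \<rightarrow> j\<close>. Every graph contains all self-loops, i.e. \<open>refl E\<close>.
\<close>

definition simple :: "'v rel \<Rightarrow> bool" where
  "simple E \<longleftrightarrow> (\<forall>i j. i \<noteq> j \<longrightarrow> \<not> ((i, j) \<in> E \<and> (j, i) \<in> E))"

definition simple_dag :: "'v::finite rel \<Rightarrow> bool" where
  "simple_dag E \<longleftrightarrow> refl E \<and> simple E \<and> acyclic (E - Id)"

definition pa :: "'v rel \<Rightarrow> 'v \<Rightarrow> 'v set" where
  "pa E i = {j. j \<noteq> i \<and> (j, i) \<in> E}"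

definition ch :: "'v rel \<Rightarrow> 'v \<Rightarrow> 'v set" where
  "ch E i = {j. j \<noteq> i \<and> (i, j) \<in> E}"

definition ne :: "'v rel \<Rightarrow> 'v \<Rightarrow> 'v set" where
  "ne E i = pa E i \<union> ch E i"


text \<open>Note the transposition: the entry in row \<open>j\<close> and column \<open>i\<close> belongs to the edge \<open>i \<rightarrow> j\<close>.\<close>

definition edge_matrices :: "'v::finite rel \<Rightarrow> (real ^ 'v ^ 'v) set" where
  "edge_matrices E = {M. \<forall>i j. (i, j) \<notin> E \<longrightarrow> M $ j $ i = 0}"

definition complex_eigenvalue :: "real ^ 'v ^ 'v::finite \<Rightarrow> complex \<Rightarrow> bool" where
  "complex_eigenvalue M z \<longleftrightarrow>
     (\<exists>x :: complex ^ 'v. x \<noteq> 0 \<and> map_matrix complex_of_real M *v x = z *s x)"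

definition stable :: "real ^ 'v ^ 'v::finite \<Rightarrow> bool" where
  "stable M \<longleftrightarrow> (\<forall>z. complex_eigenvalue M z \<longrightarrow> Re z < 0)"

definition pos_def :: "real ^ 'v ^ 'v::finite \<Rightarrow> bool" where
  "pos_def S \<longleftrightarrow> transpose S = S \<and> (\<forall>x. x \<noteq> 0 \<longrightarrow> 0 < x \<bullet> (S *v x))"

definition lyapunov_model :: "'v::finite rel \<Rightarrow> (real ^ 'v ^ 'v) set" where
  "lyapunov_model E =
     {S. pos_def S \<and>
         (\<exists>M \<in> edge_matrices E. stable M \<and> M ** S + S ** transpose M + 2 *\<^sub>R mat 1 = 0)}"


text \<open>
  A walk is given by the list of its vertices (walks along zero edges are allowed). A trek
  consists of two walks \<open>p\<close> and \<open>q\<close> with the same first vertex, the top of the trek.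
\<close>

definition walk :: "'v rel \<Rightarrow> 'v list \<Rightarrow> bool" where
  "walk E p \<longleftrightarrow> p \<noteq> [] \<and> successively (\<lambda>a b. (a, b) \<in> E) p"

definition trek :: "'v rel \<Rightarrow> 'v \<Rightarrow> 'v \<Rightarrow> 'v list \<Rightarrow> 'v list \<Rightarrow> bool" where
  "trek E i j p q \<longleftrightarrow> walk E p \<and> walk E q \<and> hd p = hd q \<and> last p = i \<and> last q = j"

text \<open>Marginal independence of \<open>k\<close> and \<open>{i, j}\<close>, through its description by treks.\<close>

definition indep :: "'v rel \<Rightarrow> 'v \<Rightarrow> 'v \<Rightarrow> 'v \<Rightarrow> bool" where
  "indep E k i j \<longleftrightarrow> (\<nexists>p q. trek E k i p q) \<and> (\<nexists>p q. trek E k j p q)"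

definition super_covered :: "'v::finite rel \<Rightarrow> 'v \<Rightarrow> 'v \<Rightarrow> bool" where
  "super_covered E i j \<longleftrightarrow>
     simple_dag E \<and> i \<noteq> j \<and> (i, j) \<in> E \<and>
     ch E i = ch E j \<union> {j} \<and> pa E i \<union> {i} = pa E j \<and>
     (\<forall>k \<in> pa E j. \<forall>l \<in> ch E i. (k, l) \<in> E) \<and>
     (\<forall>k \<in> UNIV - {i, j}. k \<in> ne E i \<inter> ne E j \<or> indep E k i j)"

definition flip :: "'v::finite rel \<Rightarrow> 'v rel \<Rightarrow> bool" where
  "flip E E' \<longleftrightarrow> (\<exists>i j. super_covered E i j \<and> E' = E - {(i, j)} \<union> {(j, i)})"

end

theory Submission
  imports Defs
begin

text \<open>
  A solution of the Lyapunov equation with \<open>\<Sigma>\<close> positive definite is automatically stable, so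
  \<open>\<Sigma>\<close> lies in the model iff \<open>M\<Sigma> + \<Sigma>M\<^sup>T + 2I = 0\<close> has a solution \<open>M\<close> with the support of the graph, and
  two solutions differ by \<open>L\<Sigma>\<^sup>-\<^sup>1\<close> with \<open>L\<close> skew-symmetric. For a super-covered edge \<open>i \<rightarrow> j\<close>, a suitable
  \<open>L\<close> of rank two moves the entry of \<open>i \<rightarrow> j\<close> to \<open>j \<rightarrow> i\<close> without leaving the support elsewhere.

  Conversely, matrices that are the identity outside a set of vertices show that equality of models is
  inherited by induced subgraphs. Explicit covariance matrices on two, three and four vertices then
  show that equivalent graphs have the same skeleton, that an edge of an unshielded triple has
  the same direction in both graphs, and that the remaining obstructions to being super-covered do not
  occur at a reversed edge. Among the reversed edges, as in Chickering's argument
  for Bayesian networks, one chooses \<open>j\<close> first and then \<open>i\<close> last in topological order; this edge is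
  covered, hence super-covered, and flipping it decreases the number of reversed edges.
\<close>

section \<open>The Lyapunov equation\<close>

lemma lyapunov_entries:
  fixes M S :: "real^'v^'v::finite"
  shows "M ** S + S ** transpose M + 2 *\<^sub>R mat 1 = 0 \<longleftrightarrow>
    (\<forall>a b. (\<Sum>c\<in>UNIV. M$a$c * S$c$b) + (\<Sum>c\<in>UNIV. S$a$c * M$b$c) = (if a = b then -2 else 0))"
proof -
  have "M ** S + S ** transpose M + 2 *\<^sub>R mat 1 = 0 \<longleftrightarrow>
    (\<forall>a b. (\<Sum>c\<in>UNIV. M$a$c * S$c$b) + (\<Sum>c\<in>UNIV. S$a$c * M$b$c) + (if a = b then 2 else 0) = 0)"
    by (simp add: vec_eq_iff matrix_matrix_mult_def transpose_def mat_def)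
  also have "\<dots> \<longleftrightarrow> (\<forall>a b. (\<Sum>c\<in>UNIV. M$a$c * S$c$b) + (\<Sum>c\<in>UNIV. S$a$c * M$b$c) = (if a = b then -2 else 0))"
    by (intro iff_allI) (auto split: if_splits)
  finally show ?thesis .
qed

lemma pos_def_symmetric: "pos_def S \<Longrightarrow> S$a$b = S$b$a"
  unfolding pos_def_def transpose_def by (metis (lifting) vec_lambda_beta)

lemma pos_def_inner:
  assumes "pos_def S"
  shows "p \<bullet> (S *v q) = q \<bullet> (S *v p)"
proof -
  have "p \<bullet> (S *v q) = (p v* S) \<bullet> q" by (simp add: dot_lmul_matrix)
  also have "p v* S = S *v p" using assms by (metis pos_def_def transpose_matrix_vector)
  finally show ?thesis by (simp add: inner_commute)
qed

text \<open>The equation is tested with \<open>p\<close> on the left and \<open>q\<close> on the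
  right; symmetry of \<open>S\<close> turns the transposed term into the first one with
  \<open>p\<close> and \<open>q\<close> exchanged. For \<open>p = q\<close> this is
  \<open>p \<bullet> (M *v (S *v p)) = - (p \<bullet> p)\<close>.\<close>

lemma lyapunov_form:
  assumes "pos_def S" and "M ** S + S ** transpose M + 2 *\<^sub>R mat 1 = 0"
  shows "p \<bullet> (M *v (S *v q)) + q \<bullet> (M *v (S *v p)) = - 2 * (p \<bullet> q)"
proof -
  have "(M ** S + S ** transpose M + 2 *\<^sub>R mat 1) *v q = 0" using assms(2) by simp
  then have "M *v (S *v q) + S *v (transpose M *v q) + 2 *\<^sub>R q = 0"
    by (simp add: matrix_vector_mult_add_rdistrib matrix_vector_mul_assoc[symmetric]
        scaleR_matrix_vector_assoc[symmetric] del: transpose_matrix_vector)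
  then have "p \<bullet> (M *v (S *v q)) + p \<bullet> (S *v (transpose M *v q)) + 2 * (p \<bullet> q) = 0"
    by (metis inner_add_right inner_scaleR_right inner_zero_right)
  moreover have "p \<bullet> (S *v (transpose M *v q)) = q \<bullet> (M *v (S *v p))"
    by (metis assms(1) dot_lmul_matrix pos_def_inner transpose_matrix_vector)
  ultimately show ?thesis by linarith
qed

lemma pos_def_surj:
  assumes "pos_def S"
  obtains p where "S *v p = x"
proof -
  have "inj ((*v) S)"
  proof (rule injI)
    fix x y assume "S *v x = S *v y"
    then have "S *v (x - y) = 0" by (simp add: matrix_vector_mult_diff_distrib)
    then have "(x - y) \<bullet> (S *v (x - y)) = 0" by simp
    then show "x = y" using assms unfolding pos_def_def by (metis eq_iff_diff_eq_0 less_irrefl)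
  qed
  then have "surj ((*v) S)"
    using linear_injective_imp_surjective matrix_vector_mul_linear by blast
  then show ?thesis using that by (metis surjD)
qed

text \<open>Lyapunov's argument in real coordinates: split an eigenvector into real part
  \<open>a\<close> and imaginary part \<open>b\<close> and pull them back through \<open>S\<close>
  to \<open>p\<close> and \<open>q\<close>. The form gives \<open>Re z * (p \<bullet> a + q
  \<bullet> b) = - (p \<bullet> p + q \<bullet> q)\<close>, where the factor of \<open>Re z\<close>
  is positive.\<close>

lemma lyapunov_stable:
  fixes M S :: "real^'v^'v::finite"
  assumes "pos_def S" and "M ** S + S ** transpose M + 2 *\<^sub>R mat 1 = 0"
  shows "stable M"
  unfolding stable_def
proof (intro allI impI)
  fix z assume "complex_eigenvalue M z"
  then obtain x :: "complex^'v" where x: "x \<noteq> 0" "map_matrix complex_of_real M *v x = z *s x"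
    unfolding complex_eigenvalue_def by blast
  define a where "a = (\<chi> k. Re (x$k))"
  define b where "b = (\<chi> k. Im (x$k))"
  have row: "(\<Sum>l\<in>UNIV. complex_of_real (M$k$l) * x$l) = z * x$k" for k
    using arg_cong[OF x(2), of "\<lambda>v. v$k"]
    by (simp add: matrix_vector_mult_def map_matrix_def)
  have Ma: "M *v a = Re z *\<^sub>R a - Im z *\<^sub>R b"
    using arg_cong[OF row, of Re] by (simp add: vec_eq_iff matrix_vector_mult_def a_def b_def)
  have Mb: "M *v b = Re z *\<^sub>R b + Im z *\<^sub>R a"
    using arg_cong[OF row, of Im] by (simp add: vec_eq_iff matrix_vector_mult_def a_def b_def)
  obtain p where p: "S *v p = a" using pos_def_surj[OF assms(1)] .
  obtain q where q: "S *v q = b" using pos_def_surj[OF assms(1)] .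
  have "p \<bullet> (M *v a) = - (p \<bullet> p)" "q \<bullet> (M *v b) = - (q \<bullet> q)"
    using lyapunov_form[OF assms, of p p] lyapunov_form[OF assms, of q q] p q by simp_all
  \<comment> \<open>By this symmetry the two terms with \<open>Im z\<close> cancel.\<close>
  moreover have "p \<bullet> b = q \<bullet> a" using pos_def_inner[OF assms(1), of p q] p q by simp
  ultimately have *: "Re z * (p \<bullet> a + q \<bullet> b) = - (p \<bullet> p + q \<bullet> q)"
    unfolding Ma Mb by (simp add: inner_diff_right inner_add_right algebra_simps)
  have nz: "p \<noteq> 0 \<or> q \<noteq> 0"
  proof (rule ccontr)
    assume "\<not> ?thesis"
    then have "a = 0" "b = 0" using p q by auto
    then have "x = 0" by (simp add: vec_eq_iff a_def b_def complex_eq_iff)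
    then show False using x by simp
  qed
  have ge: "0 \<le> r \<bullet> (S *v r)" for r
    using assms(1) unfolding pos_def_def by (cases "r = 0") (auto intro: less_imp_le)
  have "0 < p \<bullet> a + q \<bullet> b"
    using nz ge[of p] ge[of q] assms(1) p q unfolding pos_def_def
    by (metis add_nonneg_pos add_pos_nonneg)
  moreover have "0 < p \<bullet> p + q \<bullet> q"
    using nz by (metis add_nonneg_pos add_pos_nonneg inner_ge_zero inner_gt_zero_iff)
  ultimately show "Re z < 0" using *
    by (smt (verit) mult_nonneg_nonneg)
qed

lemma lyapunov_model_iff:
  "S \<in> lyapunov_model E \<longleftrightarrow>
    pos_def S \<and> (\<exists>M\<in>edge_matrices E. M ** S + S ** transpose M + 2 *\<^sub>R mat 1 = 0)"
  unfolding lyapunov_model_def using lyapunov_stable by blast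

text \<open>\<open>x\<close> is column \<open>i\<close> of the inverse of the principal block of
  \<open>S\<close> on \<open>A\<close>, padded with zeros; \<open>x$i\<close> is positive because it
  equals \<open>x \<bullet> (S *v x)\<close>.\<close>

lemma pos_def_solve_on:
  fixes S :: "real^'v^'v::finite"
  assumes "pos_def S" and "i \<in> A"
  obtains x where "\<And>c. c \<notin> A \<Longrightarrow> x$c = 0" and "\<And>c. c \<in> A \<Longrightarrow> (S *v x)$c = (if c = i then 1 else 0)"
    and "0 < x$i"
proof -
  \<comment> \<open>Filling up with the identity outside \<open>A\<close> gives a full square
    matrix, to which injective-implies-surjective applies.\<close>
  define T :: "real^'v^'v" where
    "T = (\<chi> c d. if c \<in> A \<and> d \<in> A then S$c$d else if c = d then 1 else 0)"
  have T_out: "(T *v x)$c = x$c" if "c \<notin> A" for x c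
  proof -
    have "(T *v x)$c = (\<Sum>d\<in>UNIV. if d = c then x$d else 0)"
      unfolding matrix_vector_mult_def T_def vec_lambda_beta using that by (intro sum.cong) auto
    then show ?thesis by simp
  qed
  have T_in: "(T *v x)$c = (S *v x)$c" if "c \<in> A" "\<And>d. d \<notin> A \<Longrightarrow> x$d = 0" for x c
    unfolding matrix_vector_mult_def T_def using that by (auto intro!: sum.cong)
  have inner: "x \<bullet> (S *v x) = (\<Sum>c\<in>A. x$c * (S *v x)$c)" if "\<And>d. d \<notin> A \<Longrightarrow> x$d = 0" for x
    unfolding inner_vec_def using that by (simp, intro sum.mono_neutral_right) auto
  have "inj ((*v) T)"
  proof (rule injI)
    fix x y assume "T *v x = T *v y"
    then have z: "T *v (x - y) = 0" by (simp add: matrix_vector_mult_diff_distrib)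
    have out: "(x - y)$d = 0" if "d \<notin> A" for d using T_out[OF that, of "x - y"] z by simp
    have "(x - y) \<bullet> (S *v (x - y)) = 0"
      using inner[of "x - y"] T_in[of _ "x - y"] out z by (simp add: sum.neutral)
    then show "x = y" using assms(1) unfolding pos_def_def by (metis eq_iff_diff_eq_0 less_irrefl)
  qed
  then have "surj ((*v) T)"
    using linear_injective_imp_surjective matrix_vector_mul_linear by blast
  then obtain x where x: "T *v x = axis i 1" by (metis surjD)
  have out: "x$c = 0" if "c \<notin> A" for c
    using T_out[OF that, of x] x that assms(2) by (auto simp: axis_def split: if_splits)
  have sol: "(S *v x)$c = (if c = i then 1 else 0)" if "c \<in> A" for c
    using T_in[of c x] that out x by (simp add: axis_def)
  have "x \<bullet> (S *v x) = (\<Sum>c\<in>A. x$c * (S *v x)$c)" using inner out by blast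
  also have "\<dots> = (\<Sum>c\<in>A. if c = i then x$c else 0)" by (intro sum.cong refl) (simp add: sol)
  finally have "x \<bullet> (S *v x) = x$i" using assms(2) by simp
  moreover have "x \<noteq> 0" using sol[OF assms(2)] by auto
  ultimately have "0 < x$i" using assms(1) unfolding pos_def_def by metis
  with out sol show ?thesis using that by blast
qed

section \<open>Directed acyclic graphs\<close>

lemma simple_dagD:
  assumes "simple_dag E"
  shows "(a, a) \<in> E" and "(a, b) \<in> E \<Longrightarrow> a \<noteq> b \<Longrightarrow> (b, a) \<notin> E"
  using assms unfolding simple_dag_def simple_def refl_on_def by auto

text \<open>The rank is the number of proper ancestors. It grows along an edge \<open>u -> v\<close>
  since \<open>u\<close> is an ancestor of \<open>v\<close> but, by acyclicity, not of
  itself.\<close>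

lemma simple_dag_rank:
  assumes "simple_dag E"
  obtains h :: "'v::finite \<Rightarrow> nat" where "\<And>u v. (u, v) \<in> E \<Longrightarrow> u \<noteq> v \<Longrightarrow> h u < h v"
proof
  fix u v assume uv: "(u, v) \<in> E" "u \<noteq> v"
  have "{w. (w, u) \<in> (E - Id)\<^sup>+} \<subset> {w. (w, v) \<in> (E - Id)\<^sup>+}"
  proof
    show "{w. (w, u) \<in> (E - Id)\<^sup>+} \<subseteq> {w. (w, v) \<in> (E - Id)\<^sup>+}"
      using uv by (auto intro: trancl_into_trancl)
    show "{w. (w, u) \<in> (E - Id)\<^sup>+} \<noteq> {w. (w, v) \<in> (E - Id)\<^sup>+}"
      using uv assms unfolding simple_dag_def acyclic_def by blast
  qed
  then show "card {w. (w, u) \<in> (E - Id)\<^sup>+} < card {w. (w, v) \<in> (E - Id)\<^sup>+}"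
    by (intro psubset_card_mono) auto
qed

lemma rank_rtrancl:
  fixes h :: "'v \<Rightarrow> nat"
  assumes "\<And>u v. (u, v) \<in> E \<Longrightarrow> u \<noteq> v \<Longrightarrow> h u < h v" and "(u, v) \<in> E\<^sup>*"
  shows "u = v \<or> h u < h v"
  using assms(2) by (induction rule: rtrancl_induct) (auto dest: assms(1) intro: less_trans)

section \<open>Treks as common ancestors\<close>

lemma rtrancl_iff_walk: "(\<exists>p. walk E p \<and> hd p = t \<and> last p = i) \<longleftrightarrow> (t, i) \<in> E\<^sup>*"
proof
  show "(t, i) \<in> E\<^sup>*" if "\<exists>p. walk E p \<and> hd p = t \<and> last p = i"
  proof -
    from that obtain p where p: "walk E p" "hd p = t" "last p = i" by blast
    have "walk E p \<Longrightarrow> (hd p, last p) \<in> E\<^sup>*"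
      by (induction p rule: induct_list012)
        (auto simp: walk_def intro: converse_rtrancl_into_rtrancl)
    with p show ?thesis by auto
  qed
  show "\<exists>p. walk E p \<and> hd p = t \<and> last p = i" if "(t, i) \<in> E\<^sup>*"
    using that
  proof (induction rule: converse_rtrancl_induct)
    case base
    have "walk E [i]" by (simp add: walk_def)
    then show ?case by force
  next
    case (step y z)
    then obtain p where p: "walk E p" "hd p = z" "last p = i" by blast
    then have "walk E (y # p)" using step by (cases p) (auto simp: walk_def)
    with p show ?case by (intro exI[of _ "y # p"]) (auto simp: walk_def)
  qed
qed

text \<open>Existence of a trek, phrased through its top so that reachability replaces vertex
  lists.\<close>

definition trek_connected :: "'v rel \<Rightarrow> 'v \<Rightarrow> 'v \<Rightarrow> bool" where
  "trek_connected E a b \<longleftrightarrow> (\<exists>t. (t, a) \<in> E\<^sup>* \<and> (t, b) \<in> E\<^sup>*)"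

lemma trek_connected_iff: "trek_connected E a b \<longleftrightarrow> (\<exists>p q. trek E a b p q)"
  unfolding trek_connected_def trek_def rtrancl_iff_walk[symmetric] by metis

lemma indep_iff: "indep E k i j \<longleftrightarrow> \<not> trek_connected E k i \<and> \<not> trek_connected E k j"
  unfolding indep_def trek_connected_iff ..

lemma trek_connected_refl: "trek_connected E a a"
  unfolding trek_connected_def by blast

lemma trek_connected_extend:
  "trek_connected E a c \<Longrightarrow> (c, b) \<in> E \<Longrightarrow> trek_connected E a b"
  "trek_connected E c b \<Longrightarrow> (c, a) \<in> E \<Longrightarrow> trek_connected E a b"
  unfolding trek_connected_def by (meson rtrancl.rtrancl_into_rtrancl)+

text \<open>
  On the ancestral set of \<open>a\<close>, the matrix \<open>M\<close> is triangular with \<open>a\<close> as sink, so testing the Lyapunov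
  form on column \<open>a\<close> of the inverse of the corresponding block of \<open>S\<close> isolates the entry \<open>M$a$a\<close>.
\<close>

lemma lyapunov_diagonal_neg:
  assumes "simple_dag E" and "M \<in> edge_matrices E"
    and "pos_def S" and "M ** S + S ** transpose M + 2 *\<^sub>R mat 1 = 0"
  shows "M$a$a < 0"
proof -
  obtain h :: "'a \<Rightarrow> nat" where h: "\<And>u v. (u, v) \<in> E \<Longrightarrow> u \<noteq> v \<Longrightarrow> h u < h v"
    using simple_dag_rank[OF assms(1)] by blast
  define A where "A = {u. (u, a) \<in> E\<^sup>*}"
  have "a \<in> A" by (simp add: A_def)
  obtain x where x: "\<And>c. c \<notin> A \<Longrightarrow> x$c = 0"
    "\<And>c. c \<in> A \<Longrightarrow> (S *v x)$c = (if c = a then 1 else 0)" "0 < x$a"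
    using pos_def_solve_on[OF assms(3) \<open>a \<in> A\<close>] by blast
  have entry: "x$d * (M$d$c * (S *v x)$c) = (if c = a then if d = a then x$a * M$a$a else 0 else 0)" for c d
  proof (cases "x$d = 0 \<or> M$d$c = 0")
    case True
    then show ?thesis using x(3) by auto
  next
    case False
    then have "d \<in> A" "(c, d) \<in> E" using x(1) assms(2) unfolding edge_matrices_def by auto
    then have "c \<in> A" unfolding A_def by (auto intro: converse_rtrancl_into_rtrancl)
    moreover have "d = a" if "c = a"
      using rank_rtrancl[of E h d a, OF h] \<open>d \<in> A\<close> \<open>(c, d) \<in> E\<close> that h[of a d]
      unfolding A_def by force
    ultimately show ?thesis using x(2) by auto
  qed
  have "x \<bullet> (M *v (S *v x)) = (\<Sum>d\<in>UNIV. \<Sum>c\<in>UNIV. x$d * (M$d$c * (S *v x)$c))"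
    unfolding inner_vec_def matrix_vector_mult_def[of M] by (simp add: sum_distrib_left)
  also have "\<dots> = x$a * M$a$a" unfolding entry by simp
  finally have "x$a * M$a$a = - (x \<bullet> x)"
    using lyapunov_form[OF assms(3,4), of x x] by simp
  moreover have "x \<noteq> 0" using x(3) by auto
  ultimately have "x$a * M$a$a < 0" by (metis inner_gt_zero_iff neg_less_0_iff_less)
  then show ?thesis using x(3) by (simp add: mult_less_0_iff)
qed

text \<open>Induction along the topological order. A trek from a parent of \<open>a\<close> to
  \<open>b\<close> would extend to \<open>a\<close>, so in the equation at \<open>(a, b)\<close> the
  covariances of parents of \<open>a\<close> with \<open>b\<close> vanish by induction, and likewise
  for parents of \<open>b\<close>. What remains is \<open>(M$a$a + M$b$b) * S$a$b = 0\<close> with a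
  negative first factor.\<close>

lemma lyapunov_zero_pattern:
  assumes "simple_dag E" and "M \<in> edge_matrices E"
    and "pos_def S" and "M ** S + S ** transpose M + 2 *\<^sub>R mat 1 = 0"
    and "\<not> trek_connected E a b"
  shows "S$a$b = 0"
proof -
  obtain h :: "'a \<Rightarrow> nat" where h: "\<And>u v. (u, v) \<in> E \<Longrightarrow> u \<noteq> v \<Longrightarrow> h u < h v"
    using simple_dag_rank[OF assms(1)] by blast
  show ?thesis using assms(5)
  proof (induction "h a + h b" arbitrary: a b rule: less_induct)
    case less
    have "a \<noteq> b" using less.prems trek_connected_refl by metis
    have 1: "M$a$c * S$c$b = (if c = a then M$a$a * S$a$b else 0)" for c
    proof (cases "c = a \<or> M$a$c = 0")
      case False
      then have "(c, a) \<in> E" "c \<noteq> a" using assms(2) unfolding edge_matrices_def by auto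
      then have "S$c$b = 0" using less.hyps[of c b] h less.prems trek_connected_extend by force
      then show ?thesis using False by simp
    qed auto
    have 2: "S$a$c * M$b$c = (if c = b then S$a$b * M$b$b else 0)" for c
    proof (cases "c = b \<or> M$b$c = 0")
      case False
      then have "(c, b) \<in> E" "c \<noteq> b" using assms(2) unfolding edge_matrices_def by auto
      then have "S$a$c = 0" using less.hyps[of a c] h less.prems trek_connected_extend by force
      then show ?thesis using False by simp
    qed auto
    have "(\<Sum>c\<in>UNIV. M$a$c * S$c$b) = M$a$a * S$a$b"
      by (subst sum.cong[OF refl 1]) simp
    moreover have "(\<Sum>c\<in>UNIV. S$a$c * M$b$c) = S$a$b * M$b$b"
      by (subst sum.cong[OF refl 2]) simp
    ultimately have "M$a$a * S$a$b + S$a$b * M$b$b = 0"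
      using assms(4)[unfolded lyapunov_entries, rule_format, of a b] \<open>a \<noteq> b\<close>
      by simp
    then have "(M$a$a + M$b$b) * S$a$b = 0" by (simp add: algebra_simps)
    moreover have "M$a$a + M$b$b < 0" using lyapunov_diagonal_neg[OF assms(1-4)] by (simp add: add_neg_neg)
    ultimately show ?case by simp
  qed
qed


section \<open>Super-covered flips preserve the model\<close>

text \<open>The correction to \<open>M\<close> lives in the columns of \<open>pa E j\<close> and
  \<open>j\<close>, and in the rows of \<open>i\<close>, \<open>j\<close> and the children of
  \<open>j\<close>; the independence condition kills all other rows. The conditions on parents and
  children make these positions edges of the flipped graph, except for that of
  \<open>i -> j\<close>.\<close>

lemma super_covered_subset:
  assumes sc: "super_covered E i j"
  shows "lyapunov_model E \<subseteq> lyapunov_model (E - {(i, j)} \<union> {(j, i)})"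
proof
  fix S assume "S \<in> lyapunov_model E"
  then obtain M where pd: "pos_def S" and ME: "M \<in> edge_matrices E"
    and eq: "M ** S + S ** transpose M + 2 *\<^sub>R mat 1 = 0"
    unfolding lyapunov_model_iff by blast
  from sc have dag: "simple_dag E" and ij: "i \<noteq> j" "(i, j) \<in> E"
    and chi: "ch E i = ch E j \<union> {j}" and pai: "pa E i \<union> {i} = pa E j"
    and full: "\<And>k l. k \<in> pa E j \<Longrightarrow> l \<in> ch E i \<Longrightarrow> (k, l) \<in> E"
    and rest: "\<And>k. k \<noteq> i \<Longrightarrow> k \<noteq> j \<Longrightarrow> k \<in> ne E i \<inter> ne E j \<or> indep E k i j"
    unfolding super_covered_def by auto
  define A where "A = pa E j \<union> {j}"
  have A: "i \<in> A" "j \<in> A" using pai by (auto simp: A_def)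
  obtain x where x: "\<And>c. c \<notin> A \<Longrightarrow> x$c = 0"
    "\<And>c. c \<in> A \<Longrightarrow> (S *v x)$c = (if c = i then 1 else 0)" "0 < x$i"
    using pos_def_solve_on[OF pd A(1)] by blast
  obtain y where y: "\<And>c. c \<notin> A \<Longrightarrow> y$c = 0"
    "\<And>c. c \<in> A \<Longrightarrow> (S *v y)$c = (if c = j then 1 else 0)" "0 < y$j"
    using pos_def_solve_on[OF pd A(2)] by blast
  \<comment> \<open>Every vertex of \<open>A\<close> has an edge or loop to \<open>j\<close>, so a
    trek between \<open>r\<close> and \<open>c\<close> would extend to \<open>j\<close>.\<close>
  have zero: "S$r$c = 0" if "indep E r i j" "c \<in> A" for r c
  proof (rule lyapunov_zero_pattern[OF dag ME pd eq])
    have "(c, j) \<in> E" using that(2) simple_dagD(1)[OF dag] by (auto simp: A_def pa_def)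
    then show "\<not> trek_connected E r c" using that(1) trek_connected_extend(1) unfolding indep_iff by metis
  qed
  define u where "u = S *v x"
  define w where "w = S *v y"
  have uw0: "u$r = 0" "w$r = 0" if "indep E r i j" for r
  proof -
    have "S$r$c * x$c = 0 \<and> S$r$c * y$c = 0" for c
      using zero[OF that] x(1) y(1) by (cases "c \<in> A") auto
    then show "u$r = 0" "w$r = 0"
      unfolding u_def w_def matrix_vector_mult_def vec_lambda_beta by (simp_all only: sum.neutral_const)
  qed
  \<comment> \<open>\<open>M'\<Sigma> - M\<Sigma>\<close> is the skew-symmetric matrix \<open>t (u w\<^sup>T - w u\<^sup>T)\<close>, and \<open>t\<close> is chosen to cancel the entry of \<open>i \<rightarrow> j\<close>.\<close>
  define t where "t = M$j$i / x$i"
  define M' where "M' = (\<chi> a b. M$a$b + t * (u$a * y$b - w$a * x$b))"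
  have "M' \<in> edge_matrices (E - {(i, j)} \<union> {(j, i)})"
    unfolding edge_matrices_def
  proof (intro CollectI allI impI)
    fix b a assume ba: "(b, a) \<notin> E - {(i, j)} \<union> {(j, i)}"
    show "M'$a$b = 0"
    proof (cases "(b, a) \<in> E")
      case True
      then have "b = i" "a = j" using ba by auto
      \<comment> \<open>Here \<open>u$j = 0\<close> and \<open>w$j = 1\<close>, so the entry is
        \<open>M$j$i - t * x$i\<close>.\<close>
      then show ?thesis using x(2)[OF A(2)] y(2)[OF A(2)] x(3) ij
        by (simp add: M'_def t_def u_def w_def)
    next
      case False
      then have Mab: "M$a$b = 0" using ME unfolding edge_matrices_def by blast
      show ?thesis
      proof (cases "b \<in> A")
        case False
        then show ?thesis using Mab x(1) y(1) by (simp add: M'_def)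
      next
        case bA: True
        have aij: "a \<noteq> i" "a \<noteq> j"
          using bA ba pai False simple_dagD(1)[OF dag] unfolding A_def pa_def by blast+
        have "u$a = 0 \<and> w$a = 0"
        proof (cases "a \<in> A")
          case True
          then show ?thesis using x(2) y(2) aij by (simp add: u_def w_def)
        next
          case aA: False
          have "a \<notin> ne E j"
          proof
            assume "a \<in> ne E j"
            then have "a \<in> ch E j" using aA by (simp add: ne_def A_def)
            then have "a \<in> ch E i" "(j, a) \<in> E" using chi by (auto simp: ch_def)
            then show False using full bA False unfolding A_def by blast
          qed
          then show ?thesis using rest[OF aij] uw0 by blast
        qed
        then show ?thesis using Mab by (simp add: M'_def)
      qed
    qed
  qed
  moreover have "M' ** S + S ** transpose M' + 2 *\<^sub>R mat 1 = 0"
    unfolding lyapunov_entries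
  proof (intro allI)
    fix a b
    have MS: "(\<Sum>c\<in>UNIV. M'$a$c * S$c$b) = (\<Sum>c\<in>UNIV. M$a$c * S$c$b) + t * (u$a * w$b - w$a * u$b)" for a b
    proof -
      have "(\<Sum>c\<in>UNIV. M'$a$c * S$c$b)
        = (\<Sum>c\<in>UNIV. M$a$c * S$c$b) + t * (u$a * (\<Sum>c\<in>UNIV. S$b$c * y$c) - w$a * (\<Sum>c\<in>UNIV. S$b$c * x$c))"
        unfolding M'_def
        by (simp add: algebra_simps sum.distrib sum_subtractf sum_distrib_left pos_def_symmetric[OF pd, of _ b])
      then show ?thesis by (simp add: u_def w_def matrix_vector_mult_def)
    qed
    have "(\<Sum>c\<in>UNIV. S$a$c * M'$b$c) = (\<Sum>c\<in>UNIV. M'$b$c * S$c$a)"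
      "(\<Sum>c\<in>UNIV. S$a$c * M$b$c) = (\<Sum>c\<in>UNIV. M$b$c * S$c$a)"
      by (simp_all add: pos_def_symmetric[OF pd, of _ a] mult.commute)
    then show "(\<Sum>c\<in>UNIV. M'$a$c * S$c$b) + (\<Sum>c\<in>UNIV. S$a$c * M'$b$c) = (if a = b then -2 else 0)"
      using eq[unfolded lyapunov_entries, rule_format, of a b] unfolding MS by (simp add: algebra_simps)
  qed
  ultimately show "S \<in> lyapunov_model (E - {(i, j)} \<union> {(j, i)})"
    using pd unfolding lyapunov_model_iff by blast
qed

text \<open>A new cycle would need a second path from \<open>i\<close> to \<open>j\<close>. Its last
  vertex before \<open>j\<close> is a parent of \<open>j\<close> other than \<open>i\<close>, hence
  a parent of \<open>i\<close>, which closes a cycle already in \<open>E\<close>.\<close>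

lemma simple_dag_flip:
  assumes dag: "simple_dag E" and ij: "i \<noteq> j" "(i, j) \<in> E" and pai: "pa E i \<union> {i} = pa E j"
  shows "simple_dag (E - {(i, j)} \<union> {(j, i)})"
proof -
  let ?r = "E - Id - {(i, j)}"
  have "(i, j) \<notin> ?r\<^sup>*"
  proof
    assume "(i, j) \<in> ?r\<^sup>*"
    then obtain k where k: "(i, k) \<in> ?r\<^sup>*" "(k, j) \<in> ?r" using ij by (metis rtranclE)
    then have "k \<in> pa E i" using pai unfolding pa_def by blast
    then have "(k, i) \<in> E - Id" by (simp add: pa_def)
    moreover have "(i, k) \<in> (E - Id)\<^sup>*" using k(1) rtrancl_mono[of ?r "E - Id"] by blast
    ultimately have "(i, i) \<in> (E - Id)\<^sup>+" by (meson rtrancl_into_trancl1)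
    then show False using dag unfolding simple_dag_def acyclic_def by blast
  qed
  moreover have "acyclic ?r" using dag unfolding simple_dag_def by (meson Diff_subset acyclic_subset)
  ultimately have "acyclic (insert (j, i) ?r)" by simp
  moreover have "(E - {(i, j)} \<union> {(j, i)}) - Id = insert (j, i) ?r" using ij by auto
  ultimately have "acyclic ((E - {(i, j)} \<union> {(j, i)}) - Id)" by simp
  moreover have "refl (E - {(i, j)} \<union> {(j, i)})"
    using simple_dagD(1)[OF dag] ij by (auto simp: refl_on_def)
  moreover have "simple (E - {(i, j)} \<union> {(j, i)})"
    using dag ij unfolding simple_dag_def simple_def by auto
  ultimately show ?thesis unfolding simple_dag_def by blast
qed

text \<open>This makes flips reversible and so yields the opposite inclusion of models. Only the
  independence condition takes work: a trek of the flipped graph between \<open>k\<close> and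
  \<open>i\<close> or \<open>j\<close> is traded for one of \<open>E\<close> between
  \<open>k\<close> and \<open>j\<close>.\<close>

lemma super_covered_flip:
  assumes sc: "super_covered E i j"
  shows "super_covered (E - {(i, j)} \<union> {(j, i)}) j i"
proof -
  let ?E = "E - {(i, j)} \<union> {(j, i)}"
  from sc have dag: "simple_dag E" and ij: "i \<noteq> j" "(i, j) \<in> E"
    and chi: "ch E i = ch E j \<union> {j}" and pai: "pa E i \<union> {i} = pa E j"
    and full: "\<And>k l. k \<in> pa E j \<Longrightarrow> l \<in> ch E i \<Longrightarrow> (k, l) \<in> E"
    and rest: "\<And>k. k \<noteq> i \<Longrightarrow> k \<noteq> j \<Longrightarrow> k \<in> ne E i \<inter> ne E j \<or> indep E k i j"
    unfolding super_covered_def by auto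
  have dag': "simple_dag ?E" using simple_dag_flip[OF dag ij pai] .
  have ji: "(j, i) \<notin> E" using simple_dagD(2)[OF dag] ij by blast
  have c: "ch ?E j = ch E j \<union> {i}" "ch ?E i = ch E j"
    using ij chi unfolding ch_def by auto
  have p: "pa ?E i = pa E i \<union> {j}" "pa ?E j = pa E i"
    using ij pai unfolding pa_def by auto
  have full': "(k, l) \<in> ?E" if "k \<in> pa ?E i" "l \<in> ch ?E j" for k l
  proof -
    have kl: "k = j \<or> k \<in> pa E i" "l = i \<or> l \<in> ch E j" using that unfolding p c by auto
    then have "k = j \<or> k \<in> pa E j" "l = i \<or> l \<in> ch E i" using pai chi by blast+
    then have "(k, l) \<in> E \<or> k = j \<and> l = i" using kl full unfolding pa_def ch_def by blast
    moreover have "k \<noteq> i" using that(1) by (simp add: pa_def)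
    ultimately show ?thesis by blast
  qed
  \<comment> \<open>A parent of a parent of \<open>j\<close> has a trek to \<open>j\<close>, so it
    is \<open>i\<close> or a neighbor of \<open>j\<close>, and acyclicity rules out a child. Hence
    ancestors in the flipped graph never leave this set.\<close>
  have top: "t \<in> insert j (pa E j)" if "(t, v) \<in> ?E\<^sup>*" "v \<in> {i, j}" for t v
    using that
  proof (induction rule: converse_rtrancl_induct)
    case base
    then show ?case using pai by auto
  next
    case (step t s)
    then have s: "s \<in> insert j (pa E j)" by simp
    show ?case
    proof (cases "(t, s) \<in> E \<and> s \<noteq> j \<and> t \<noteq> s")
      case True
      then have "s \<in> pa E j" using s by simp
      then have "t \<in> ne E i \<inter> ne E j \<or> t = i \<or> t = j \<or> indep E t i j" using rest by blast
      moreover have "trek_connected E t j"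
        using \<open>s \<in> pa E j\<close> True trek_connected_refl trek_connected_extend(1)
        unfolding pa_def by (metis (lifting) mem_Collect_eq)
      moreover have "t \<notin> ch E j"
      proof
        assume "t \<in> ch E j"
        then have "(j, t) \<in> E - Id" "(t, s) \<in> E - Id" "(s, j) \<in> E - Id"
          using True \<open>s \<in> pa E j\<close> unfolding ch_def pa_def by auto
        then have "(j, j) \<in> (E - Id)\<^sup>+" by (meson trancl.simps)
        then show False using dag unfolding simple_dag_def acyclic_def by blast
      qed
      ultimately show ?thesis using pai unfolding indep_iff ne_def by auto
    next
      case False
      then show ?thesis using s step.hyps(1) ij by (auto simp: pa_def)
    qed
  qed
  \<comment> \<open>After its last use of the new edge \<open>j -> i\<close>, a path runs from
    \<open>i\<close> inside \<open>E\<close>.\<close>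
  have down: "(t, k) \<in> E\<^sup>* \<or> (i, k) \<in> E\<^sup>*" if "(t, k) \<in> ?E\<^sup>*" for t k
    using that
  proof (induction rule: converse_rtrancl_induct)
    case (step t s)
    then have "(t, s) \<in> E \<or> t = j \<and> s = i" by blast
    then show ?case using step.IH converse_rtrancl_into_rtrancl[of t s E k] by blast
  qed simp
  have indep': "indep ?E k i j" if "indep E k i j" for k
  proof -
    have "\<not> trek_connected ?E k v" if v: "v \<in> {i, j}" for v
    proof
      assume "trek_connected ?E k v"
      then obtain t where t: "(t, k) \<in> ?E\<^sup>*" "(t, v) \<in> ?E\<^sup>*" unfolding trek_connected_def by blast
      have "(t, j) \<in> E" using top[OF t(2) v] simple_dagD(1)[OF dag] by (auto simp: pa_def)
      then have "trek_connected E k j" using down[OF t(1)] ij unfolding trek_connected_def by blast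
      then show False using \<open>indep E k i j\<close> unfolding indep_iff by blast
    qed
    then show ?thesis unfolding indep_iff by blast
  qed
  have rest': "k \<in> ne ?E j \<inter> ne ?E i \<or> indep ?E k j i" if "k \<noteq> i" "k \<noteq> j" for k
  proof -
    have "ne ?E i = ne E i" "ne ?E j = ne E j"
      unfolding ne_def c p using chi pai by auto
    then show ?thesis using rest[OF that] indep' unfolding indep_iff by blast
  qed
  show ?thesis
    unfolding super_covered_def
  proof (intro conjI)
    show "ch ?E j = ch ?E i \<union> {i}" unfolding c ..
    show "pa ?E j \<union> {j} = pa ?E i" unfolding p ..
    show "\<forall>k\<in>UNIV - {j, i}. k \<in> ne ?E j \<inter> ne ?E i \<or> indep ?E k j i" using rest' by auto
  qed (use dag' ij full' in auto)
qed

lemma flip_lyapunov_model: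
  assumes "flip E E'"
  shows "lyapunov_model E = lyapunov_model E'"
proof -
  obtain i j where sc: "super_covered E i j" and E': "E' = E - {(i, j)} \<union> {(j, i)}"
    using assms unfolding flip_def by blast
  from sc have "i \<noteq> j" "(i, j) \<in> E" "(j, i) \<notin> E"
    using simple_dagD(2)[of E i j] unfolding super_covered_def by auto
  then have "E = E' - {(j, i)} \<union> {(i, j)}" unfolding E' by auto
  then have "lyapunov_model E' \<subseteq> lyapunov_model E"
    using super_covered_subset[OF super_covered_flip[OF sc]] unfolding E' by simp
  then show ?thesis using super_covered_subset[OF sc] unfolding E' by blast
qed

section \<open>Passing to induced subgraphs\<close>

text \<open>\<open>S\<close> is padded by the identity and \<open>M\<close> by minus the identity,
  which solves the equation off the chosen vertices. Since the padded \<open>S\<close> is block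
  diagonal, a solution supported on \<open>E2\<close> restricts to the small system even if it has
  entries between the block and its complement. Numbers as indices let the simplifier expand the
  small sums.\<close>

lemma induced_equations:
  fixes g :: "nat \<Rightarrow> 'v::finite" and m s :: "nat \<Rightarrow> nat \<Rightarrow> real"
  assumes model: "lyapunov_model E1 = lyapunov_model E2" and "refl E1"
    and inj: "inj_on g {..<n}"
    and sym: "\<forall>p<n. \<forall>q<n. s p q = s q p"
    and supp: "\<forall>p<n. \<forall>q<n. m p q \<noteq> 0 \<longrightarrow> (g q, g p) \<in> E1"
    and eq: "\<forall>p<n. \<forall>q<n. (\<Sum>r<n. m p r * s r q) + (\<Sum>r<n. s p r * m q r) = (if p = q then -2 else 0)"
    and pos: "\<And>x. (\<exists>p<n. x p \<noteq> 0) \<Longrightarrow> 0 < (\<Sum>p<n. x p * (\<Sum>q<n. s p q * x q))"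
  obtains N :: "nat \<Rightarrow> nat \<Rightarrow> real"
    where "\<forall>p<n. \<forall>q<n. (g q, g p) \<notin> E2 \<longrightarrow> N p q = 0"
    and "\<forall>p<n. \<forall>q<n. (\<Sum>r<n. N p r * s r q) + (\<Sum>r<n. s p r * N q r) = (if p = q then -2 else 0)"
proof -
  define G where "G = g ` {..<n}"
  define k where "k = inv_into {..<n} g"
  have kg: "k (g p) = p" if "p < n" for p using that inj unfolding k_def by (simp add: inv_into_f_f)
  have gG: "g p \<in> G" if "p < n" for p using that by (simp add: G_def)
  have Gg: "\<exists>p<n. v = g p" if "v \<in> G" for v using that by (auto simp: G_def)
  define S :: "real^'v^'v" where
    "S = (\<chi> u v. if u \<in> G \<and> v \<in> G then s (k u) (k v) else if u = v then 1 else 0)"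
  define M :: "real^'v^'v" where
    "M = (\<chi> u v. if u \<in> G \<and> v \<in> G then m (k u) (k v) else if u = v then -1 else 0)"
  have Sg: "S$(g p)$(g q) = s p q" "M$(g p)$(g q) = m p q" if "p < n" "q < n" for p q
    using that by (simp_all add: S_def M_def gG kg)
  have S0: "S$u$v = (if u = v then 1 else 0)" "M$u$v = (if u = v then -1 else 0)" if "u \<notin> G \<or> v \<notin> G" for u v
    using that by (auto simp: S_def M_def)
  have split: "(\<Sum>c\<in>UNIV. f c) = (\<Sum>r<n. f (g r)) + (\<Sum>c\<in>-G. f c)" for f :: "'v \<Rightarrow> real"
  proof -
    have "(\<Sum>c\<in>UNIV. f c) = (\<Sum>c\<in>G. f c) + (\<Sum>c\<in>-G. f c)"
      using sum.subset_diff[of G UNIV f] by (simp add: Compl_eq_Diff_UNIV)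
    also have "(\<Sum>c\<in>G. f c) = (\<Sum>r<n. f (g r))"
      unfolding G_def using inj by (simp add: sum.reindex)
    finally show ?thesis .
  qed
  have sumG: "(\<Sum>c\<in>UNIV. f c) = (\<Sum>r<n. f (g r))" if "\<And>c. c \<notin> G \<Longrightarrow> f c = 0" for f :: "'v \<Rightarrow> real"
    unfolding split using that by (simp add: sum.neutral)
  have Ssym: "S$u$v = S$v$u" for u v
    using sym Gg[of u] Gg[of v] Sg S0[of u v] S0[of v u] by (cases "u \<in> G \<and> v \<in> G") auto
  have "pos_def S"
    unfolding pos_def_def
  proof (intro conjI allI impI)
    show "transpose S = S" using Ssym by (simp add: transpose_def vec_eq_iff)
    fix x :: "real^'v" assume "x \<noteq> 0"
    have row: "(S *v x)$(g p) = (\<Sum>q<n. s p q * x$(g q))" if "p < n" for p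
      unfolding matrix_vector_mult_def using gG[OF that] that S0(1)
      by (simp, subst sumG) (auto simp: Sg)
    have row': "(S *v x)$u = x$u" if "u \<notin> G" for u
    proof -
      have "(S *v x)$u = (\<Sum>c\<in>UNIV. if u = c then x$c else 0)"
        unfolding matrix_vector_mult_def vec_lambda_beta using S0(1) that by (intro sum.cong) auto
      then show ?thesis by simp
    qed
    have form: "x \<bullet> (S *v x) = (\<Sum>p<n. x$(g p) * (\<Sum>q<n. s p q * x$(g q))) + (\<Sum>u\<in>-G. x$u * x$u)"
      unfolding inner_vec_def split using row row' by simp
    have ge: "0 \<le> (\<Sum>u\<in>-G. x$u * x$u)" by (intro sum_nonneg) simp
    show "0 < x \<bullet> (S *v x)"
    proof (cases "\<exists>p<n. x$(g p) \<noteq> 0")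
      case True
      then show ?thesis using pos[of "\<lambda>p. x$(g p)"] ge unfolding form by (simp add: add_pos_nonneg)
    next
      case False
      from \<open>x \<noteq> 0\<close> obtain u where u: "x$u \<noteq> 0" by (auto simp: vec_eq_iff)
      then have "u \<in> -G" using False Gg by blast
      then have "0 < (\<Sum>u\<in>-G. x$u * x$u)" using u
        by (intro sum_pos2[of _ u]) (auto simp: zero_less_mult_iff linorder_neq_iff)
      then show ?thesis unfolding form using False by simp
    qed
  qed
  moreover have "M \<in> edge_matrices E1"
    unfolding edge_matrices_def
  proof (intro CollectI allI impI)
    fix v u assume vu: "(v, u) \<notin> E1"
    then have "u \<noteq> v" using \<open>refl E1\<close> by (auto simp: refl_on_def)
    show "M$u$v = 0"
    proof (cases "u \<in> G \<and> v \<in> G")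
      case True
      then obtain p q where "p < n" "q < n" "u = g p" "v = g q" using Gg by blast
      then show ?thesis using vu supp Sg by auto
    next
      case False
      then show ?thesis using S0(2) \<open>u \<noteq> v\<close> by auto
    qed
  qed
  moreover have "M ** S + S ** transpose M + 2 *\<^sub>R mat 1 = 0"
    unfolding lyapunov_entries
  proof (intro allI)
    fix a b
    show "(\<Sum>c\<in>UNIV. M$a$c * S$c$b) + (\<Sum>c\<in>UNIV. S$a$c * M$b$c) = (if a = b then -2 else 0)"
    proof (cases "a \<in> G \<and> b \<in> G")
      case True
      then obtain p q where pq: "p < n" "q < n" "a = g p" "b = g q" using Gg by blast
      have "(g p = g q) = (p = q)" using pq inj by (auto simp: inj_on_def)
      moreover have "(\<Sum>c\<in>UNIV. M$a$c * S$c$b) = (\<Sum>r<n. m p r * s r q)"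
        using True by (subst sumG) (auto simp: S0 Sg pq)
      moreover have "(\<Sum>c\<in>UNIV. S$a$c * M$b$c) = (\<Sum>r<n. s p r * m q r)"
        using True by (subst sumG) (auto simp: S0 Sg pq)
      ultimately show ?thesis using eq pq by simp
    next
      case False
      have "M$a$c * S$c$b = (if c = a then if a = b then -1 else 0 else 0)" for c
        using False S0[of a c] S0[of c b] by (cases "c \<in> G") (auto split: if_splits)
      moreover have "S$a$c * M$b$c = (if c = b then if a = b then -1 else 0 else 0)" for c
        using False S0[of a c] S0[of b c] by (cases "c \<in> G") (auto split: if_splits)
      ultimately show ?thesis using False by simp
    qed
  qed
  ultimately have "S \<in> lyapunov_model E2" using model lyapunov_model_iff by blast
  then obtain M2 where M2: "M2 \<in> edge_matrices E2" "M2 ** S + S ** transpose M2 + 2 *\<^sub>R mat 1 = 0"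
    unfolding lyapunov_model_iff by blast
  show ?thesis
  proof
    show "\<forall>p<n. \<forall>q<n. (g q, g p) \<notin> E2 \<longrightarrow> M2$(g p)$(g q) = 0"
      using M2(1) unfolding edge_matrices_def by blast
    show "\<forall>p<n. \<forall>q<n. (\<Sum>r<n. M2$(g p)$(g r) * s r q) + (\<Sum>r<n. s p r * M2$(g q)$(g r))
      = (if p = q then -2 else 0)"
    proof (intro allI impI)
      fix p q assume pq: "p < n" "q < n"
      have "(g p = g q) = (p = q)" using pq inj by (auto simp: inj_on_def)
      moreover have "(\<Sum>c\<in>UNIV. M2$(g p)$c * S$c$(g q)) = (\<Sum>r<n. M2$(g p)$(g r) * s r q)"
        using gG pq S0 by (subst sumG) (auto simp: Sg)
      moreover have "(\<Sum>c\<in>UNIV. S$(g p)$c * M2$(g q)$c) = (\<Sum>r<n. s p r * M2$(g q)$(g r))"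
        using gG pq S0 by (subst sumG) (auto simp: Sg)
      ultimately show "(\<Sum>r<n. M2$(g p)$(g r) * s r q) + (\<Sum>r<n. s p r * M2$(g q)$(g r))
        = (if p = q then -2 else 0)"
        using M2(2)[unfolded lyapunov_entries, rule_format, of "g p" "g q"] by simp
    qed
  qed
qed


section \<open>Witnesses on small graphs\<close>

text \<open>
  In each of the following lemmas \<open>m\<close> is supported on a few edges of \<open>E1\<close>, \<open>s\<close> solves its Lyapunov
  equation and is positive by its \<open>LDL\<^sup>T\<close> decomposition, and the linear system for a solution supported
  on \<open>E2\<close> is inconsistent.
\<close>

lemma weighted_squares_pos:
  fixes a b c d :: real
  assumes "0 < u" "0 < v" "0 < w" "0 < z" and "a \<noteq> 0 \<or> b \<noteq> 0 \<or> c \<noteq> 0 \<or> d \<noteq> 0"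
  shows "0 < u * a\<^sup>2 + v * b\<^sup>2 + w * c\<^sup>2 + z * d\<^sup>2"
proof -
  have "0 \<le> u * a\<^sup>2" "0 \<le> v * b\<^sup>2" "0 \<le> w * c\<^sup>2" "0 \<le> z * d\<^sup>2" using assms by simp_all
  moreover have "0 < u * a\<^sup>2 \<or> 0 < v * b\<^sup>2 \<or> 0 < w * c\<^sup>2 \<or> 0 < z * d\<^sup>2" using assms by auto
  ultimately show ?thesis by linarith
qed

lemmas bounded_nat_simps = All_less_Suc Ex_less_Suc eval_nat_numeral

text \<open>A solution on \<open>E2\<close> would be diagonal. The diagonal equations force
  \<open>N 0 0 = -1\<close> and \<open>N 1 1 = -1/3\<close>, and the nonzero covariance then
  violates the off-diagonal equation.\<close>

lemma adjacent_preserved: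
  fixes i j :: "'v::finite"
  assumes model: "lyapunov_model E1 = lyapunov_model E2" and refl: "refl E1"
    and dist: "distinct [i, j]"
    and E1: "(i, j) \<in> E1"
    and E2: "(i, j) \<notin> E2" "(j, i) \<notin> E2"
  shows False
proof -
  define m :: "nat \<Rightarrow> nat \<Rightarrow> real" where
    "m p q = [[-1, 0], [2, -1]] ! p ! q" for p q
  define s :: "nat \<Rightarrow> nat \<Rightarrow> real" where
    "s p q = [[1, 1], [1, 3]] ! p ! q" for p q
  define g where "g = (!) [i, j]"
  obtain N :: "nat \<Rightarrow> nat \<Rightarrow> real"
    where "\<forall>p<2. \<forall>q<2. (g q, g p) \<notin> E2 \<longrightarrow> N p q = 0"
      and "\<forall>p<2. \<forall>q<2. (\<Sum>r<2. N p r * s r q) + (\<Sum>r<2. s p r * N q r) = (if p = q then -2 else 0)"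
  proof (rule induced_equations[OF model refl, of g 2 s m])
    show "inj_on g {..<2}" unfolding g_def by (rule inj_on_nth[OF dist]) simp
    show "\<forall>p<2. \<forall>q<2. m p q \<noteq> 0 \<longrightarrow> (g q, g p) \<in> E1"
      using E1 refl unfolding g_def m_def by (simp add: bounded_nat_simps refl_on_def)
    fix x :: "nat \<Rightarrow> real" assume "\<exists>p<2. x p \<noteq> 0"
    then have "x 0 + x 1 \<noteq> 0 \<or> x 1 \<noteq> 0 \<or> (0::real) \<noteq> 0 \<or> (0::real) \<noteq> 0"
      by (auto simp: bounded_nat_simps)
    from weighted_squares_pos[OF _ _ _ _ this, of 1 2 1 1]
    show "0 < (\<Sum>p<2. x p * (\<Sum>q<2. s p q * x q))"
      by (simp add: s_def bounded_nat_simps power2_eq_square algebra_simps)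
  qed (simp_all add: m_def s_def bounded_nat_simps)
  then show False using E2 by (auto simp: g_def s_def bounded_nat_simps)
qed

text \<open>At most five entries of \<open>N\<close> can be nonzero, against six equations.\<close>

lemma unshielded_chain_preserved:
  fixes a c b :: "'v::finite"
  assumes model: "lyapunov_model E1 = lyapunov_model E2" and refl: "refl E1"
    and dist: "distinct [a, c, b]"
    and E1: "(a, c) \<in> E1" "(c, b) \<in> E1"
    and E2: "(a, c) \<notin> E2" "(a, b) \<notin> E2" "(b, a) \<notin> E2" "(c, b) \<notin> E2 \<or> (b, c) \<notin> E2"
  shows False
proof -
  define m :: "nat \<Rightarrow> nat \<Rightarrow> real" where
    "m p q = [[-1, 0, 0], [2, -1, 0], [0, 2, -1]] ! p ! q" for p q
  define s :: "nat \<Rightarrow> nat \<Rightarrow> real" where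
    "s p q = [[1, 1, 1], [1, 3, 4], [1, 4, 9]] ! p ! q" for p q
  define g where "g = (!) [a, c, b]"
  obtain N :: "nat \<Rightarrow> nat \<Rightarrow> real"
    where "\<forall>p<3. \<forall>q<3. (g q, g p) \<notin> E2 \<longrightarrow> N p q = 0"
      and "\<forall>p<3. \<forall>q<3. (\<Sum>r<3. N p r * s r q) + (\<Sum>r<3. s p r * N q r) = (if p = q then -2 else 0)"
  proof (rule induced_equations[OF model refl, of g 3 s m])
    show "inj_on g {..<3}" unfolding g_def by (rule inj_on_nth[OF dist]) simp
    show "\<forall>p<3. \<forall>q<3. m p q \<noteq> 0 \<longrightarrow> (g q, g p) \<in> E1"
      using E1 refl unfolding g_def m_def by (simp add: bounded_nat_simps refl_on_def)
    fix x :: "nat \<Rightarrow> real" assume "\<exists>p<3. x p \<noteq> 0"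
    then have "x 0 + x 1 + x 2 \<noteq> 0 \<or> x 1 + 3 / 2 * x 2 \<noteq> 0 \<or> x 2 \<noteq> 0 \<or> (0::real) \<noteq> 0"
      by (auto simp: bounded_nat_simps)
    from weighted_squares_pos[OF _ _ _ _ this, of 1 2 "7 / 2" 1]
    show "0 < (\<Sum>p<3. x p * (\<Sum>q<3. s p q * x q))"
      by (simp add: s_def bounded_nat_simps power2_eq_square algebra_simps)
  qed (simp_all add: m_def s_def bounded_nat_simps)
  then show False using E2 by (auto simp: g_def s_def bounded_nat_simps)
qed

text \<open>The same count with \<open>b -> c\<close> in place of \<open>c -> b\<close>; the two
  lemmas cover both directions of the second edge.\<close>

lemma unshielded_collider_preserved:
  fixes a c b :: "'v::finite"
  assumes model: "lyapunov_model E1 = lyapunov_model E2" and refl: "refl E1"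
    and dist: "distinct [a, c, b]"
    and E1: "(a, c) \<in> E1" "(b, c) \<in> E1"
    and E2: "(a, c) \<notin> E2" "(a, b) \<notin> E2" "(b, a) \<notin> E2" "(c, b) \<notin> E2 \<or> (b, c) \<notin> E2"
  shows False
proof -
  define m :: "nat \<Rightarrow> nat \<Rightarrow> real" where
    "m p q = [[-1, 0, 0], [2, -1, 2], [0, 0, -1]] ! p ! q" for p q
  define s :: "nat \<Rightarrow> nat \<Rightarrow> real" where
    "s p q = [[1, 1, 0], [1, 5, 1], [0, 1, 1]] ! p ! q" for p q
  define g where "g = (!) [a, c, b]"
  obtain N :: "nat \<Rightarrow> nat \<Rightarrow> real"
    where "\<forall>p<3. \<forall>q<3. (g q, g p) \<notin> E2 \<longrightarrow> N p q = 0"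
      and "\<forall>p<3. \<forall>q<3. (\<Sum>r<3. N p r * s r q) + (\<Sum>r<3. s p r * N q r) = (if p = q then -2 else 0)"
  proof (rule induced_equations[OF model refl, of g 3 s m])
    show "inj_on g {..<3}" unfolding g_def by (rule inj_on_nth[OF dist]) simp
    show "\<forall>p<3. \<forall>q<3. m p q \<noteq> 0 \<longrightarrow> (g q, g p) \<in> E1"
      using E1 refl unfolding g_def m_def by (simp add: bounded_nat_simps refl_on_def)
    fix x :: "nat \<Rightarrow> real" assume "\<exists>p<3. x p \<noteq> 0"
    then have "x 0 + x 1 \<noteq> 0 \<or> x 1 + 1 / 4 * x 2 \<noteq> 0 \<or> x 2 \<noteq> 0 \<or> (0::real) \<noteq> 0"
      by (auto simp: bounded_nat_simps)
    from weighted_squares_pos[OF _ _ _ _ this, of 1 4 "3 / 4" 1]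
    show "0 < (\<Sum>p<3. x p * (\<Sum>q<3. s p q * x q))"
      by (simp add: s_def bounded_nat_simps power2_eq_square algebra_simps)
  qed (simp_all add: m_def s_def bounded_nat_simps)
  then show False using E2 by (auto simp: g_def s_def bounded_nat_simps)
qed

text \<open>Serves the condition that parents of \<open>j\<close> point to children of
  \<open>i\<close>. The witness uses only \<open>k -> j <- i -> l\<close>, so \<open>k\<close> is
  uncorrelated with \<open>i\<close> and \<open>l\<close>; the equation at \<open>(k, l)\<close>
  then kills the entry of \<open>j -> l\<close>, and the remaining equations contradict each
  other.\<close>

lemma flip_parent_child:
  fixes k i j l :: "'v::finite"
  assumes model: "lyapunov_model E1 = lyapunov_model E2" and refl: "refl E1"
    and dist: "distinct [k, i, j, l]"
    and E1: "(k, j) \<in> E1" "(i, j) \<in> E1" "(i, l) \<in> E1"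
    and E2: "(i, j) \<notin> E2" "(i, k) \<notin> E2" "(j, k) \<notin> E2" "(l, i) \<notin> E2"
      "(l, j) \<notin> E2" "(k, l) \<notin> E2" "(l, k) \<notin> E2"
  shows False
proof -
  define m :: "nat \<Rightarrow> nat \<Rightarrow> real" where
    "m p q = [[-1, 0, 0, 0], [0, -1, 0, 0], [1, 1, -1, 0], [0, 1, 0, -1]] ! p ! q" for p q
  define s :: "nat \<Rightarrow> nat \<Rightarrow> real" where
    "s p q = [[1, 0, 1 / 2, 0], [0, 1, 1 / 2, 1 / 2], [1 / 2, 1 / 2, 2, 1 / 2], [0, 1 / 2, 1 / 2, 3 / 2]] ! p ! q" for p q
  define g where "g = (!) [k, i, j, l]"
  obtain N :: "nat \<Rightarrow> nat \<Rightarrow> real"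
    where "\<forall>p<4. \<forall>q<4. (g q, g p) \<notin> E2 \<longrightarrow> N p q = 0"
      and "\<forall>p<4. \<forall>q<4. (\<Sum>r<4. N p r * s r q) + (\<Sum>r<4. s p r * N q r) = (if p = q then -2 else 0)"
  proof (rule induced_equations[OF model refl, of g 4 s m])
    show "inj_on g {..<4}" unfolding g_def by (rule inj_on_nth[OF dist]) simp
    show "\<forall>p<4. \<forall>q<4. m p q \<noteq> 0 \<longrightarrow> (g q, g p) \<in> E1"
      using E1 refl unfolding g_def m_def by (simp add: bounded_nat_simps refl_on_def)
    fix x :: "nat \<Rightarrow> real" assume "\<exists>p<4. x p \<noteq> 0"
    then have "x 0 + 1 / 2 * x 2 \<noteq> 0 \<or> x 1 + 1 / 2 * x 2 + 1 / 2 * x 3 \<noteq> 0 \<or> x 2 + 1 / 6 * x 3 \<noteq> 0 \<or> x 3 \<noteq> 0"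
      by (auto simp: bounded_nat_simps)
    from weighted_squares_pos[OF _ _ _ _ this, of 1 1 "3 / 2" "29 / 24"]
    show "0 < (\<Sum>p<4. x p * (\<Sum>q<4. s p q * x q))"
      by (simp add: s_def bounded_nat_simps power2_eq_square algebra_simps)
  qed (simp_all add: m_def s_def bounded_nat_simps)
  then show False using E2 by (auto simp: g_def s_def bounded_nat_simps)
qed

text \<open>First of three configurations where \<open>r\<close> is joined to a common neighbor
  \<open>c\<close> of \<open>i\<close> and \<open>j\<close> but to neither of these, and a trek
  through \<open>c\<close> would break independence. Here \<open>c\<close> is a child and
  \<open>r\<close> a child of \<open>c\<close>. In each of the three, \<open>E2\<close> leaves at
  most eight unknowns for ten equations.\<close>

lemma flip_child_descendant:
  fixes i j c r :: "'v::finite"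
  assumes model: "lyapunov_model E1 = lyapunov_model E2" and refl: "refl E1"
    and dist: "distinct [i, j, c, r]"
    and E1: "(i, j) \<in> E1" "(i, c) \<in> E1" "(c, r) \<in> E1"
    and E2: "(i, j) \<notin> E2" "(c, i) \<notin> E2" "(c, j) \<notin> E2" "(r, c) \<notin> E2"
      "(i, r) \<notin> E2" "(r, i) \<notin> E2" "(j, r) \<notin> E2" "(r, j) \<notin> E2"
  shows False
proof -
  define m :: "nat \<Rightarrow> nat \<Rightarrow> real" where
    "m p q = [[-1, 0, 0, 0], [2, -1, 0, 0], [2, 0, -1, 0], [0, 0, 2, -1]] ! p ! q" for p q
  define s :: "nat \<Rightarrow> nat \<Rightarrow> real" where
    "s p q = [[1, 1, 1, 1], [1, 3, 2, 3], [1, 2, 3, 4], [1, 3, 4, 9]] ! p ! q" for p q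
  define g where "g = (!) [i, j, c, r]"
  obtain N :: "nat \<Rightarrow> nat \<Rightarrow> real"
    where "\<forall>p<4. \<forall>q<4. (g q, g p) \<notin> E2 \<longrightarrow> N p q = 0"
      and "\<forall>p<4. \<forall>q<4. (\<Sum>r<4. N p r * s r q) + (\<Sum>r<4. s p r * N q r) = (if p = q then -2 else 0)"
  proof (rule induced_equations[OF model refl, of g 4 s m])
    show "inj_on g {..<4}" unfolding g_def by (rule inj_on_nth[OF dist]) simp
    show "\<forall>p<4. \<forall>q<4. m p q \<noteq> 0 \<longrightarrow> (g q, g p) \<in> E1"
      using E1 refl unfolding g_def m_def by (simp add: bounded_nat_simps refl_on_def)
    fix x :: "nat \<Rightarrow> real" assume "\<exists>p<4. x p \<noteq> 0"
    then have "x 0 + x 1 + x 2 + x 3 \<noteq> 0 \<or> x 1 + 1 / 2 * x 2 + x 3 \<noteq> 0 \<or> x 2 + 4 / 3 * x 3 \<noteq> 0 \<or> x 3 \<noteq> 0"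
      by (auto simp: bounded_nat_simps)
    from weighted_squares_pos[OF _ _ _ _ this, of 1 2 "3 / 2" "10 / 3"]
    show "0 < (\<Sum>p<4. x p * (\<Sum>q<4. s p q * x q))"
      by (simp add: s_def bounded_nat_simps power2_eq_square algebra_simps)
  qed (simp_all add: m_def s_def bounded_nat_simps)
  then show False using E2 by (auto simp: g_def s_def bounded_nat_simps)
qed

text \<open>Here \<open>c\<close> is a parent and \<open>r\<close> a child of
  \<open>c\<close>.\<close>

lemma flip_parent_descendant:
  fixes i j c r :: "'v::finite"
  assumes model: "lyapunov_model E1 = lyapunov_model E2" and refl: "refl E1"
    and dist: "distinct [i, j, c, r]"
    and E1: "(i, j) \<in> E1" "(c, j) \<in> E1" "(c, r) \<in> E1"
    and E2: "(i, j) \<notin> E2" "(i, c) \<notin> E2" "(j, c) \<notin> E2" "(r, c) \<notin> E2"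
      "(i, r) \<notin> E2" "(r, i) \<notin> E2" "(j, r) \<notin> E2" "(r, j) \<notin> E2"
  shows False
proof -
  define m :: "nat \<Rightarrow> nat \<Rightarrow> real" where
    "m p q = [[-1, 0, 0, 0], [2, -1, 2, 0], [0, 0, -1, 0], [0, 0, 2, -1]] ! p ! q" for p q
  define s :: "nat \<Rightarrow> nat \<Rightarrow> real" where
    "s p q = [[1, 1, 0, 0], [1, 5, 1, 2], [0, 1, 1, 1], [0, 2, 1, 3]] ! p ! q" for p q
  define g where "g = (!) [i, j, c, r]"
  obtain N :: "nat \<Rightarrow> nat \<Rightarrow> real"
    where "\<forall>p<4. \<forall>q<4. (g q, g p) \<notin> E2 \<longrightarrow> N p q = 0"
      and "\<forall>p<4. \<forall>q<4. (\<Sum>r<4. N p r * s r q) + (\<Sum>r<4. s p r * N q r) = (if p = q then -2 else 0)"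
  proof (rule induced_equations[OF model refl, of g 4 s m])
    show "inj_on g {..<4}" unfolding g_def by (rule inj_on_nth[OF dist]) simp
    show "\<forall>p<4. \<forall>q<4. m p q \<noteq> 0 \<longrightarrow> (g q, g p) \<in> E1"
      using E1 refl unfolding g_def m_def by (simp add: bounded_nat_simps refl_on_def)
    fix x :: "nat \<Rightarrow> real" assume "\<exists>p<4. x p \<noteq> 0"
    then have "x 0 + x 1 \<noteq> 0 \<or> x 1 + 1 / 4 * x 2 + 1 / 2 * x 3 \<noteq> 0 \<or> x 2 + 2 / 3 * x 3 \<noteq> 0 \<or> x 3 \<noteq> 0"
      by (auto simp: bounded_nat_simps)
    from weighted_squares_pos[OF _ _ _ _ this, of 1 4 "3 / 4" "5 / 3"]
    show "0 < (\<Sum>p<4. x p * (\<Sum>q<4. s p q * x q))"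
      by (simp add: s_def bounded_nat_simps power2_eq_square algebra_simps)
  qed (simp_all add: m_def s_def bounded_nat_simps)
  then show False using E2 by (auto simp: g_def s_def bounded_nat_simps)
qed

text \<open>Here \<open>c\<close> is a parent and \<open>r\<close> a parent of \<open>c\<close>. The
  fourth possibility, \<open>r -> c\<close> with \<open>c\<close> a common child, is a collider,
  which no trek passes.\<close>

lemma flip_ancestor:
  fixes i j c r :: "'v::finite"
  assumes model: "lyapunov_model E1 = lyapunov_model E2" and refl: "refl E1"
    and dist: "distinct [i, j, c, r]"
    and E1: "(i, j) \<in> E1" "(c, j) \<in> E1" "(r, c) \<in> E1"
    and E2: "(i, j) \<notin> E2" "(i, c) \<notin> E2" "(j, c) \<notin> E2" "(c, r) \<notin> E2"
      "(i, r) \<notin> E2" "(r, i) \<notin> E2" "(j, r) \<notin> E2" "(r, j) \<notin> E2"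
  shows False
proof -
  define m :: "nat \<Rightarrow> nat \<Rightarrow> real" where
    "m p q = [[-1, 0, 0, 0], [2, -1, 2, 0], [0, 0, -1, 2], [0, 0, 0, -1]] ! p ! q" for p q
  define s :: "nat \<Rightarrow> nat \<Rightarrow> real" where
    "s p q = [[1, 1, 0, 0], [1, 11, 4, 1], [0, 4, 3, 1], [0, 1, 1, 1]] ! p ! q" for p q
  define g where "g = (!) [i, j, c, r]"
  obtain N :: "nat \<Rightarrow> nat \<Rightarrow> real"
    where "\<forall>p<4. \<forall>q<4. (g q, g p) \<notin> E2 \<longrightarrow> N p q = 0"
      and "\<forall>p<4. \<forall>q<4. (\<Sum>r<4. N p r * s r q) + (\<Sum>r<4. s p r * N q r) = (if p = q then -2 else 0)"
  proof (rule induced_equations[OF model refl, of g 4 s m])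
    show "inj_on g {..<4}" unfolding g_def by (rule inj_on_nth[OF dist]) simp
    show "\<forall>p<4. \<forall>q<4. m p q \<noteq> 0 \<longrightarrow> (g q, g p) \<in> E1"
      using E1 refl unfolding g_def m_def by (simp add: bounded_nat_simps refl_on_def)
    fix x :: "nat \<Rightarrow> real" assume "\<exists>p<4. x p \<noteq> 0"
    then have "x 0 + x 1 \<noteq> 0 \<or> x 1 + 2 / 5 * x 2 + 1 / 10 * x 3 \<noteq> 0 \<or> x 2 + 3 / 7 * x 3 \<noteq> 0 \<or> x 3 \<noteq> 0"
      by (auto simp: bounded_nat_simps)
    from weighted_squares_pos[OF _ _ _ _ this, of 1 10 "7 / 5" "9 / 14"]
    show "0 < (\<Sum>p<4. x p * (\<Sum>q<4. s p q * x q))"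
      by (simp add: s_def bounded_nat_simps power2_eq_square algebra_simps)
  qed (simp_all add: m_def s_def bounded_nat_simps)
  then show False using E2 by (auto simp: g_def s_def bounded_nat_simps)
qed


section \<open>Choosing the edge to flip\<close>

definition adjacent :: "'v rel \<Rightarrow> 'v \<Rightarrow> 'v \<Rightarrow> bool" where
  "adjacent E a b \<longleftrightarrow> (a, b) \<in> E \<or> (b, a) \<in> E"

lemma adjacent_sym: "adjacent E a b \<longleftrightarrow> adjacent E b a"
  unfolding adjacent_def by blast

lemma adjacent_eq:
  assumes "simple_dag E1" and "simple_dag E2" and "lyapunov_model E1 = lyapunov_model E2"
  shows "adjacent E1 a b \<longleftrightarrow> adjacent E2 a b"
proof -
  have "adjacent E' a b" if "simple_dag E" "simple_dag E'" "lyapunov_model E = lyapunov_model E'" "adjacent E a b"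
    for E E' :: "'a rel"
  proof (cases "a = b")
    case True
    then show ?thesis using simple_dagD(1)[OF that(2)] by (simp add: adjacent_def)
  next
    case False
    have "refl E" using that(1) by (simp add: simple_dag_def)
    show ?thesis
      using adjacent_preserved[OF that(3) \<open>refl E\<close>, of a b] adjacent_preserved[OF that(3) \<open>refl E\<close>, of b a] False that(4)
      unfolding adjacent_def by auto
  qed
  then show ?thesis using assms by metis
qed

text \<open>By symmetry between the graphs it is enough to carry \<open>a -> c\<close> over, with
  the chain and collider lemmas for the two directions of the other edge. The opposite direction
  follows because adjacency agrees.\<close>

lemma unshielded_edge_preserved:
  assumes dag: "simple_dag E1" "simple_dag E2" and model: "lyapunov_model E1 = lyapunov_model E2"
    and neq: "a \<noteq> c" "b \<noteq> c" and adj: "adjacent E1 a c" "adjacent E1 c b" and nadj: "\<not> adjacent E1 a b"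
  shows "(a, c) \<in> E1 \<longleftrightarrow> (a, c) \<in> E2" and "(c, a) \<in> E1 \<longleftrightarrow> (c, a) \<in> E2"
proof -
  have *: "(a, c) \<in> E'" if "simple_dag E" "simple_dag E'" "lyapunov_model E = lyapunov_model E'"
    "(a, c) \<in> E" "adjacent E c b" "\<not> adjacent E a b" for E E' :: "'a rel"
  proof (rule ccontr)
    assume no: "(a, c) \<notin> E'"
    have refl: "refl E" using that(1) by (simp add: simple_dag_def)
    have "a \<noteq> b" using that(6) simple_dagD(1)[OF that(1)] by (auto simp: adjacent_def)
    then have dist: "distinct [a, c, b]" using neq by auto
    have "(a, b) \<notin> E'" "(b, a) \<notin> E'"
      using that(6) unfolding adjacent_eq[OF that(1-3)] by (auto simp: adjacent_def)
    moreover have "(c, b) \<notin> E' \<or> (b, c) \<notin> E'" using simple_dagD(2)[OF that(2)] neq by blast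
    ultimately show False
      using that(5) unshielded_chain_preserved[OF that(3) refl dist that(4) _ no]
        unshielded_collider_preserved[OF that(3) refl dist that(4) _ no]
      unfolding adjacent_def by blast
  qed
  have adj2: "adjacent E2 c b" "\<not> adjacent E2 a b" "adjacent E2 a c"
    using adj nadj adjacent_eq[OF dag model] by blast+
  show 1: "(a, c) \<in> E1 \<longleftrightarrow> (a, c) \<in> E2"
    using *[OF dag model _ adj(2) nadj] *[OF dag(2,1) model[symmetric] _ adj2(1,2)] by blast
  show "(c, a) \<in> E1 \<longleftrightarrow> (c, a) \<in> E2"
    using 1 adj(1) adj2(3) simple_dagD(2)[OF dag(1), of a c] simple_dagD(2)[OF dag(2), of a c] neq
    unfolding adjacent_def by blast
qed

lemma ex_super_covered:
  fixes E1 E2 :: "'v::finite rel"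
  assumes dag: "simple_dag E1" "simple_dag E2" and model: "lyapunov_model E1 = lyapunov_model E2"
    and "\<not> E1 \<subseteq> E2"
  obtains i j where "super_covered E1 i j" and "(i, j) \<notin> E2" and "(j, i) \<in> E2"
proof -
  have refl: "refl E1" using dag by (simp add: simple_dag_def)
  have loop: "(v, v) \<in> E1" "(v, v) \<in> E2" for v using simple_dagD(1)[OF dag(1)] simple_dagD(1)[OF dag(2)] by auto
  note adj_eq = adjacent_eq[OF dag model]
  note unshielded = unshielded_edge_preserved[OF dag model]
  obtain h :: "'v \<Rightarrow> nat" where h: "\<And>u v. (u, v) \<in> E1 \<Longrightarrow> u \<noteq> v \<Longrightarrow> h u < h v"
    using simple_dag_rank[OF dag(1)] by blast
  have orient: "(a, b) \<in> E1" if "adjacent E1 a b" "h a < h b" for a b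
    using that h[of b a] unfolding adjacent_def by fastforce
  define F where "F = E1 - E2"
  have "\<exists>j. \<exists>i. (i, j) \<in> F" using assms(4) by (auto simp: F_def)
  then obtain j where "\<exists>i. (i, j) \<in> F" and j_min: "\<And>j' i'. (i', j') \<in> F \<Longrightarrow> h j \<le> h j'"
    using ex_has_least_nat[of "\<lambda>j. \<exists>i. (i, j) \<in> F" _ h] by blast
  have "\<forall>i. (i, j) \<in> F \<longrightarrow> h i < Suc (Max (range h))" by (simp add: less_Suc_eq_le)
  with \<open>\<exists>i. (i, j) \<in> F\<close> obtain i where "(i, j) \<in> F" and i_max: "\<And>i'. (i', j) \<in> F \<Longrightarrow> h i' \<le> h i"
    using ex_has_greatest_nat[of "\<lambda>i. (i, j) \<in> F" _ h "Suc (Max (range h))"] by blast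
  then have ij: "(i, j) \<in> E1" "(i, j) \<notin> E2" by (auto simp: F_def)
  then have "i \<noteq> j" using loop by blast
  then have hij: "h i < h j" using h ij by blast
  have ji: "(j, i) \<in> E2" using adj_eq[of i j] ij unfolding adjacent_def by blast
  have adj_ij: "adjacent E1 i j" "adjacent E1 j i" using ij by (auto simp: adjacent_def)
  \<comment> \<open>Otherwise the edge between \<open>i\<close> and \<open>j\<close> lies in an
    unshielded triple with \<open>k\<close> and could not be reversed.\<close>
  have twin: "adjacent E1 k i \<longleftrightarrow> adjacent E1 k j" if "k \<noteq> i" "k \<noteq> j" for k
    using unshielded(2)[of j i k] unshielded(1)[of i j k] that \<open>i \<noteq> j\<close> adj_ij ij adjacent_sym by metis
  have pai: "pa E1 i \<union> {i} = pa E1 j"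
  proof (intro equalityI subsetI)
    fix k assume "k \<in> pa E1 i \<union> {i}"
    then consider "k = i" | "k \<noteq> i" "(k, i) \<in> E1" by (auto simp: pa_def)
    then show "k \<in> pa E1 j"
    proof cases
      case 1
      then show ?thesis using ij \<open>i \<noteq> j\<close> by (simp add: pa_def)
    next
      case 2
      then have "h k < h j" using h[of k i] hij by simp
      moreover have "adjacent E1 k j" using twin[of k] 2 \<open>h k < h j\<close> unfolding adjacent_def by blast
      ultimately show ?thesis using orient by (auto simp: pa_def)
    qed
  next
    fix k assume "k \<in> pa E1 j"
    then have k: "k \<noteq> j" "(k, j) \<in> E1" by (auto simp: pa_def)
    show "k \<in> pa E1 i \<union> {i}"
    proof (rule ccontr)
      assume no: "\<not> ?thesis"
      then have "k \<noteq> i" "(k, i) \<notin> E1" by (auto simp: pa_def)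
      moreover from this have ik: "(i, k) \<in> E1" using twin[of k] k unfolding adjacent_def by blast
      \<comment> \<open>Now \<open>i -> k -> j\<close>: maximality of \<open>i\<close> keeps
        \<open>k -> j\<close> in \<open>E2\<close>, minimality of \<open>j\<close> keeps
        \<open>i -> k\<close>, and \<open>j -> i\<close> closes a cycle.\<close>
      ultimately have "(k, j) \<in> E2" using i_max[of k] h[of i k] k by (auto simp: F_def)
      have "(i, k) \<in> E2" using j_min[of i k] h[OF k(2,1)] ik by (auto simp: F_def)
      have "(k, i) \<in> (E2 - Id)\<^sup>+" "(i, k) \<in> E2 - Id"
        using \<open>(k, j) \<in> E2\<close> ji k \<open>i \<noteq> j\<close> \<open>(i, k) \<in> E2\<close> \<open>k \<noteq> i\<close>
        by (auto intro: trancl_into_trancl)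
      then have "(k, k) \<in> (E2 - Id)\<^sup>+" by (rule trancl_into_trancl)
      then show False using dag(2) unfolding simple_dag_def acyclic_def by blast
    qed
  qed
  have chi: "ch E1 i = ch E1 j \<union> {j}"
  proof (intro equalityI subsetI)
    fix k assume "k \<in> ch E1 i"
    then have k: "k \<noteq> i" "(i, k) \<in> E1" by (auto simp: ch_def)
    show "k \<in> ch E1 j \<union> {j}"
    proof (rule ccontr)
      assume no: "\<not> ?thesis"
      then have "k \<noteq> j" "(j, k) \<notin> E1" by (auto simp: ch_def)
      then have "(k, j) \<in> E1" using twin[of k] k unfolding adjacent_def by blast
      then have "k \<in> pa E1 i" using pai \<open>k \<noteq> j\<close> k by (auto simp: pa_def)
      then show False using simple_dagD(2)[OF dag(1), of i k] k by (auto simp: pa_def)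
    qed
  next
    fix k assume "k \<in> ch E1 j \<union> {j}"
    then consider "k = j" | "k \<noteq> j" "(j, k) \<in> E1" by (auto simp: ch_def)
    then show "k \<in> ch E1 i"
    proof cases
      case 1
      then show ?thesis using ij \<open>i \<noteq> j\<close> by (simp add: ch_def)
    next
      case 2
      then have "h i < h k" using h[of j k] hij by simp
      moreover have "adjacent E1 i k" using twin[of k] 2 \<open>h i < h k\<close> unfolding adjacent_def by blast
      ultimately show ?thesis using orient by (auto simp: ch_def)
    qed
  qed
  have full: "(k, l) \<in> E1" if k: "k \<in> pa E1 j" and l: "l \<in> ch E1 i" for k l
  proof (cases "k = i \<or> l = j")
    case True
    then show ?thesis using k l by (auto simp: pa_def ch_def)
  next
    case False
    then have E: "(k, j) \<in> E1" "(k, i) \<in> E1" "(i, l) \<in> E1" "(j, l) \<in> E1"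
      and neq: "k \<noteq> i" "k \<noteq> j" "l \<noteq> i" "l \<noteq> j"
      using k l pai chi by (auto simp: pa_def ch_def)
    have "h k < h i" "h i < h l" using h E neq by blast+
    then have "h k < h l" by simp
    show ?thesis
    proof (cases "adjacent E1 k l")
      case True
      then show ?thesis using orient \<open>h k < h l\<close> by blast
    next
      case nadj: False
      then have nadj': "\<not> adjacent E1 l k" by (simp add: adjacent_sym)
      have adj: "adjacent E1 k i" "adjacent E1 k j" "adjacent E1 l i" "adjacent E1 l j"
        "adjacent E1 i l" "adjacent E1 j l" "adjacent E1 i k" "adjacent E1 j k"
        using E by (auto simp: adjacent_def)
      \<comment> \<open>If \<open>k\<close> and \<open>l\<close> are not adjacent, both
        \<open>i\<close> and \<open>j\<close> are middle vertices of unshielded triples, so these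
        four edges keep their directions.\<close>
      have "(k, i) \<in> E2" "(k, j) \<in> E2" "(i, l) \<in> E2" "(j, l) \<in> E2"
        using unshielded(1)[of k i l] unshielded(1)[of k j l] unshielded(2)[of l i k] unshielded(2)[of l j k]
          adj E neq nadj nadj' by simp_all
      then have "(i, k) \<notin> E2" "(j, k) \<notin> E2" "(l, i) \<notin> E2" "(l, j) \<notin> E2"
        using simple_dagD(2)[OF dag(2)] neq by blast+
      moreover have "(k, l) \<notin> E2" "(l, k) \<notin> E2"
        using nadj unfolding adj_eq by (auto simp: adjacent_def)
      moreover have "distinct [k, i, j, l]" using neq \<open>i \<noteq> j\<close> \<open>h k < h l\<close> by auto
      ultimately have False using flip_parent_child[OF model refl] E ij by blast
      then show ?thesis ..
    qed
  qed
  \<comment> \<open>Self-loops make \<open>adjacent\<close> reflexive, so \<open>i\<close> and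
    \<open>j\<close> themselves belong to \<open>N\<close>.\<close>
  define N where "N = {k. adjacent E1 k i \<and> adjacent E1 k j}"
  have ijN: "i \<in> N" "j \<in> N" using adj_ij loop by (auto simp: N_def adjacent_def)
  \<comment> \<open>Beyond the common neighbours of \<open>i\<close> and \<open>j\<close>, only colliders at their common children are possible.\<close>
  have outside: False
    if c: "c \<in> N" "c \<noteq> i" "c \<noteq> j" and r: "r \<notin> N" "adjacent E1 c r"
      and dir: "(c, r) \<in> E1 \<or> (c, j) \<in> E1" for c r
  proof -
    have "r \<noteq> i" "r \<noteq> j" using r ijN by auto
    then have nadj: "\<not> adjacent E1 i r" "\<not> adjacent E1 j r" "\<not> adjacent E1 r i"
      using r(1) twin[of r] \<open>r \<noteq> i\<close> \<open>r \<noteq> j\<close> by (auto simp: N_def adjacent_def)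
    have "c \<noteq> r" using c r by auto
    have adj: "adjacent E1 i c" "adjacent E1 j c" "adjacent E1 r c" "adjacent E1 c i"
      using c r by (auto simp: N_def adjacent_def)
    \<comment> \<open>\<open>r\<close> is adjacent to neither \<open>i\<close> nor \<open>j\<close>,
      so the edges of \<open>c\<close> to \<open>i\<close>, \<open>j\<close> and \<open>r\<close>
      all lie in unshielded triples.\<close>
    have eq: "(i, c) \<in> E1 \<longleftrightarrow> (i, c) \<in> E2" "(c, i) \<in> E1 \<longleftrightarrow> (c, i) \<in> E2"
      "(j, c) \<in> E1 \<longleftrightarrow> (j, c) \<in> E2" "(c, j) \<in> E1 \<longleftrightarrow> (c, j) \<in> E2"
      "(r, c) \<in> E1 \<longleftrightarrow> (r, c) \<in> E2" "(c, r) \<in> E1 \<longleftrightarrow> (c, r) \<in> E2"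
      using unshielded[of i c r] unshielded[of j c r] unshielded[of r c i]
        adj r(2) nadj c(2,3) \<open>c \<noteq> r\<close> by simp_all
    have dist: "distinct [i, j, c, r]" using c(2,3) \<open>i \<noteq> j\<close> \<open>c \<noteq> r\<close> \<open>r \<noteq> i\<close> \<open>r \<noteq> j\<close> by auto
    have n2: "(i, r) \<notin> E2" "(r, i) \<notin> E2" "(j, r) \<notin> E2" "(r, j) \<notin> E2"
      using nadj unfolding adj_eq by (auto simp: adjacent_def)
    have anti: "(a, b) \<in> E1 \<Longrightarrow> a \<noteq> b \<Longrightarrow> (b, a) \<notin> E1" for a b using simple_dagD(2)[OF dag(1)] by blast
    show False
    proof (cases "(c, j) \<in> E1")
      case True
      then have "(c, i) \<in> E1" using pai c by (auto simp: pa_def)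
      have none: "(i, c) \<notin> E2" "(j, c) \<notin> E2" using eq anti True \<open>(c, i) \<in> E1\<close> c by blast+
      show False
      proof (cases "(c, r) \<in> E1")
        case c_r: True
        then have "(r, c) \<notin> E2" using eq anti \<open>c \<noteq> r\<close> by blast
        then show False
          using flip_parent_descendant[OF model refl dist ij(1) True c_r ij(2) none _ n2] by blast
      next
        case False
        then have "(r, c) \<in> E1" "(c, r) \<notin> E2" using r(2) eq unfolding adjacent_def by blast+
        then show False
          using flip_ancestor[OF model refl dist ij(1) True _ ij(2) none _ n2] by blast
      qed
    next
      case False
      then have c_r: "(c, r) \<in> E1" and "(j, c) \<in> E1" using dir adj(2) unfolding adjacent_def by blast+
      then have "(i, c) \<in> E1" using chi c by (auto simp: ch_def)
      have "(c, i) \<notin> E2" "(c, j) \<notin> E2" "(r, c) \<notin> E2"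
        using eq anti c_r \<open>(i, c) \<in> E1\<close> \<open>(j, c) \<in> E1\<close> c \<open>c \<noteq> r\<close> by blast+
      then show False
        using flip_child_descendant[OF model refl dist ij(1) \<open>(i, c) \<in> E1\<close> c_r ij(2) _ _ _ n2] by blast
    qed
  qed
  have down: "r \<in> N" if "(t, r) \<in> E1\<^sup>*" "t \<in> N" for t r
    using that
  proof (induction rule: rtrancl_induct)
    case (step c r)
    then have c: "c \<in> N" "adjacent E1 c r" by (auto simp: adjacent_def)
    show ?case
    proof (cases "c = i \<or> c = j")
      case True
      then show ?thesis using twin[of r] c(2) ijN by (auto simp: N_def adjacent_def)
    next
      case False
      then show ?thesis using outside[of c r] c step.hyps(2) by blast
    qed
  qed
  \<comment> \<open>The rank bound excludes \<open>j -> s\<close>; a vertex \<open>s\<close> other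
    than \<open>i\<close> and \<open>j\<close> is then a parent of \<open>j\<close>, as
    \<open>outside\<close> requires.\<close>
  have up: "t \<in> N \<and> h t \<le> h j" if "(t, v) \<in> E1\<^sup>*" "v \<in> {i, j}" for t v
    using that
  proof (induction rule: converse_rtrancl_induct)
    case base
    then show ?case using ijN hij by auto
  next
    case (step t s)
    then have s: "s \<in> N" "h s \<le> h j" by auto
    have "h t \<le> h s" using h[of t s] step.hyps(1) by (cases "t = s") auto
    have adj: "adjacent E1 s t" using step.hyps(1) by (simp add: adjacent_def)
    have "t \<in> N"
    proof (cases "s = i \<or> s = j")
      case True
      then show ?thesis using twin[of t] adj ijN by (auto simp: N_def adjacent_def)
    next
      case False
      then have "(j, s) \<notin> E1" using h[of j s] s by auto
      then have "(s, j) \<in> E1" using s unfolding N_def adjacent_def by blast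
      then show ?thesis using outside[of s t] s adj False by blast
    qed
    then show ?case using \<open>h t \<le> h s\<close> s by simp
  qed
  have rest: "k \<in> ne E1 i \<inter> ne E1 j \<or> indep E1 k i j" if "k \<noteq> i" "k \<noteq> j" for k
  proof (cases "k \<in> N")
    case True
    then show ?thesis using that unfolding N_def adjacent_def ne_def pa_def ch_def by blast
  next
    case False
    \<comment> \<open>The top of a trek between \<open>k\<close> and \<open>i\<close> or
      \<open>j\<close> would lie in \<open>N\<close> by \<open>up\<close>, and then \<open>k\<close>
      as well by \<open>down\<close>.\<close>
    then show ?thesis using up down unfolding indep_iff trek_connected_def by blast
  qed
  have "super_covered E1 i j"
    unfolding super_covered_def using dag(1) \<open>i \<noteq> j\<close> ij(1) chi pai full rest by blast
  then show ?thesis using that ij(2) ji by blast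
qed

text \<open>Each flip trades an edge outside \<open>E2\<close> for one inside, so
  \<open>E1 - E2\<close> loses exactly one element and the number of flips is exact.\<close>

lemma flip_sequence:
  fixes E1 E2 :: "'v::finite rel"
  assumes "simple_dag E1" and "simple_dag E2" and "lyapunov_model E1 = lyapunov_model E2"
  shows "(flip ^^ card (E1 - E2)) E1 E2"
  using assms
proof (induction "card (E1 - E2)" arbitrary: E1)
  case 0
  then have "E1 \<subseteq> E2" by simp
  \<comment> \<open>Simple graphs with the same adjacencies and nested edge sets coincide.\<close>
  moreover have "E2 \<subseteq> E1"
  proof (rule subrelI)
    fix a b assume ab: "(a, b) \<in> E2"
    then have "adjacent E1 a b" using adjacent_eq[OF 0(2-4)] by (simp add: adjacent_def)
    then show "(a, b) \<in> E1"
      using ab \<open>E1 \<subseteq> E2\<close> simple_dagD(2)[OF 0(3), of a b] simple_dagD(1)[OF 0(2)] unfolding adjacent_def by blast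
  qed
  ultimately show ?case using 0 by simp
next
  case (Suc n)
  then have "\<not> E1 \<subseteq> E2" by (metis Diff_eq_empty_iff card.empty nat.distinct(1))
  then obtain i j where sc: "super_covered E1 i j" and ij: "(i, j) \<notin> E2" "(j, i) \<in> E2"
    using ex_super_covered[OF Suc.prems] by blast
  define E where "E = E1 - {(i, j)} \<union> {(j, i)}"
  have "flip E1 E" using sc unfolding flip_def E_def by blast
  have "(i, j) \<in> E1 - E2" using sc ij unfolding super_covered_def by blast
  moreover have "E - E2 = (E1 - E2) - {(i, j)}" using ij unfolding E_def by blast
  ultimately have "n = card (E - E2)" using Suc.hyps(2) by simp
  moreover have "simple_dag E"
    using super_covered_flip[OF sc] unfolding E_def super_covered_def by blast
  moreover have "lyapunov_model E = lyapunov_model E2"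
    using flip_lyapunov_model[OF \<open>flip E1 E\<close>] Suc.prems(3) by simp
  ultimately have "(flip ^^ n) E E2" using Suc.hyps(1) Suc.prems(2) by blast
  then show ?case using relpowp_Suc_I2[of flip, OF \<open>flip E1 E\<close>] Suc.hyps(2) by metis
qed

theorem theorem3p7:
  fixes E1 E2 :: "'v::finite rel"
  assumes "simple_dag E1" and "simple_dag E2"
  shows "(lyapunov_model E1 = lyapunov_model E2 \<longleftrightarrow> flip\<^sup>*\<^sup>* E1 E2) \<and>
    (lyapunov_model E1 = lyapunov_model E2 \<longrightarrow> (flip ^^ card (E1 - E2)) E1 E2)"
proof -
  have "lyapunov_model E1 = lyapunov_model E2" if "flip\<^sup>*\<^sup>* E1 E2"
    using that by (induction rule: rtranclp_induct) (auto dest: flip_lyapunov_model)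
  then show ?thesis using flip_sequence[OF assms] relpowp_imp_rtranclp by metis
qed

end
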